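(* Let $(X,d)$ be a bounded, geometrically doubling quasi-metric space whose $d$-balls are open sets. Let $\alpha>0$, $1<p<\infty$, and let $q:X\to(1,\infty)$ be a $\mu$-measurable function (with $\mu$ the measure below) such that $1<p<q_-\le q(x)\le q_+<\infty$ for all $x\in X$, where $q_-=\inf_X q$ and $q_+=\sup_X q$. Let $\lambda:X\times\mathbb{R}^+\to\mathbb{R}^+$ be a function that is doubling, and which, as a function of its second variable $r$, is non-decreasing and of lower type greater than $\alpha$. Assume that $$r^{\alpha}\le \lambda(x,r)^{\frac1p-\frac1{q(x)}}\qquad\text{for all }x\in X,\ r>0.$$ Let $\mu$ be a Borel measure on $X$ which is finite on bounded sets, positive on the balls, satisfies $\mu(\{x\})=0$ for all $x\in X$, and is upper doubling with dominating function $\lambda$. Then the operator $$I_{\alpha}^{\lambda} f(x)=\int_X \frac{d(x,y)^{\alpha}}{\lambda(x,d(x,y))}\,f(y)\,d\mu(y)$$ is bounded from $L^p(X,d,\mu)$ to $L^{q(\cdot)}(X,d,\mu)$; that is, there is a constant $C$ such that $\|I_\alpha^\lambda f\|_{q(\cdot)}\le C\|f\|_p$ for all $f\in L^p(X,d,\mu)$.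
   Context: Quasi-metric: a function $d:X\times X\to[0,\infty)$ with $d(x,y)=0$ iff $x=y$, $d(x,y)=d(y,x)$, and $d(x,y)\le K_1(d(x,z)+d(z,y))$ for all $x,y,z\in X$ and some finite constant $K_1>0$. Balls: $B(x,r)=\{y\in X: d(y,x)<r\}$. Bounded means $\operatorname{diam}(X)<\infty$. $(X,d)$ is geometrically doubling if there is a natural number $N$ such that every ball $B(x,r)$ can be covered by at most $N$ balls of radius $r/2$. $\mathbb{R}^+=(0,\infty)$. The function $\lambda$ is doubling if there is a constant $C_\lambda$ with $\lambda(x,2r)\le C_\lambda\lambda(x,r)$ for all $x\in X$, $r>0$. It is of lower type greater than $\alpha$ (as a function of $r$) if there are $\alpha_0>\alpha$ and a constant $c_1$ such that $\lambda(x,st)\le c_1 s^{\alpha_0}\lambda(x,t)$ for all $x\in X$, $0<s\le1$, $t>0$. The measure $\mu$ is upper doubling with dominating function $\lambda$ if $\lambda$ is doubling, $r\mapsto\lambda(x,r)$ is non-decreasing, and $\mu(B(x,r))\le\lambda(x,r)$ for all $x\in X$ and $r>0$. Since $\mu(\{x\})=0$, the value of the kernel at $y=x$ is irrelevant. Variable Lebesgue space: for $\mu$-measurable $q:X\to[1,\infty)$ with $1<q_-\le q(x)\le q_+<\infty$, $L^{q(\cdot)}(X,d,\mu)$ is the space of $\mu$-measurable $f$ with $I_{q(\cdot)}(f)=\int_X|f(x)|^{q(x)}\,d\mu(x)<\infty$, normed by $\|f\|_{q(\cdot)}=\inf\{t>0: I_{q(\cdot)}(f/t)\le1\}$.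
   Formalization: Since λ(·,r) is not assumed measurable, I_α^λ f can be non-measurable; membership in L^{q(·)} is therefore claimed only when I_α^λ f is μ-measurable, and otherwise the norm inequality is read with the lower integral. *)

theory Defs
  imports "HOL-Analysis.Analysis"
begin

locale quasi_metric =
  fixes X :: "'a set" and d :: "'a \<Rightarrow> 'a \<Rightarrow> real"
  assumes nonneg: "\<And>x y. x \<in> X \<Longrightarrow> y \<in> X \<Longrightarrow> 0 \<le> d x y"
    and zero_iff: "\<And>x y. x \<in> X \<Longrightarrow> y \<in> X \<Longrightarrow> d x y = 0 \<longleftrightarrow> x = y"
    and commute: "\<And>x y. x \<in> X \<Longrightarrow> y \<in> X \<Longrightarrow> d x y = d y x"
    and quasi_triangle:
      "\<exists>K1>0. \<forall>x\<in>X. \<forall>y\<in>X. \<forall>z\<in>X. d x y \<le> K1 * (d x z + d z y)"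

definition qball :: "'a set \<Rightarrow> ('a \<Rightarrow> 'a \<Rightarrow> real) \<Rightarrow> 'a \<Rightarrow> real \<Rightarrow> 'a set" where
  "qball X d x r = {y \<in> X. d y x < r}"

definition qbounded :: "('a \<Rightarrow> 'a \<Rightarrow> real) \<Rightarrow> 'a set \<Rightarrow> bool" where
  "qbounded d A \<longleftrightarrow> (\<exists>D. \<forall>x\<in>A. \<forall>y\<in>A. d x y \<le> D)"

definition geometrically_doubling :: "'a set \<Rightarrow> ('a \<Rightarrow> 'a \<Rightarrow> real) \<Rightarrow> bool" where
  "geometrically_doubling X d \<longleftrightarrow>
     (\<exists>N::nat. \<forall>x\<in>X. \<forall>r>0. \<exists>F\<subseteq>X. finite F \<and> card F \<le> N \<and>
        qball X d x r \<subseteq> (\<Union>y\<in>F. qball X d y (r/2)))"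

text \<open>The topology of a quasi-metric: a set is open iff it contains a ball about each of its
  points. The balls themselves need not be open.\<close>

definition qtopology :: "'a set \<Rightarrow> ('a \<Rightarrow> 'a \<Rightarrow> real) \<Rightarrow> 'a topology" where
  "qtopology X d = topology (\<lambda>U. U \<subseteq> X \<and> (\<forall>x\<in>U. \<exists>r>0. qball X d x r \<subseteq> U))"

lemma openin_qtopology:
  "openin (qtopology X d) U \<longleftrightarrow> U \<subseteq> X \<and> (\<forall>x\<in>U. \<exists>r>0. qball X d x r \<subseteq> U)"
proof -
  let ?L = "\<lambda>U. U \<subseteq> X \<and> (\<forall>x\<in>U. \<exists>r>0. qball X d x r \<subseteq> U)"
  have "?L (S \<inter> T)" if S: "?L S" and T: "?L T" for S T
  proof (intro conjI ballI)
    show "S \<inter> T \<subseteq> X" using S by blast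
    fix x assume x: "x \<in> S \<inter> T"
    obtain r where r: "r > 0" "qball X d x r \<subseteq> S" using S x by blast
    obtain s where s: "s > 0" "qball X d x s \<subseteq> T" using T x by blast
    have "qball X d x (min r s) \<subseteq> S \<inter> T" using r s by (auto simp: qball_def)
    then show "\<exists>r>0. qball X d x r \<subseteq> S \<inter> T" using r s by (intro exI[of _ "min r s"]) auto
  qed
  moreover have "?L (\<Union>\<U>)" if "\<forall>U\<in>\<U>. ?L U" for \<U>
    using that by (meson Union_iff Union_least Union_upper order_trans)
  ultimately have "istopology ?L" unfolding istopology_def by blast
  then show ?thesis by (simp add: qtopology_def topology_inverse')
qed

definition qborel :: "'a set \<Rightarrow> ('a \<Rightarrow> 'a \<Rightarrow> real) \<Rightarrow> 'a measure" where
  "qborel X d = sigma X {U. openin (qtopology X d) U}"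

definition doubling_fun :: "'a set \<Rightarrow> ('a \<Rightarrow> real \<Rightarrow> real) \<Rightarrow> bool" where
  "doubling_fun X l \<longleftrightarrow> (\<exists>C. \<forall>x\<in>X. \<forall>r>0. l x (2 * r) \<le> C * l x r)"

definition lower_type_greater :: "'a set \<Rightarrow> ('a \<Rightarrow> real \<Rightarrow> real) \<Rightarrow> real \<Rightarrow> bool" where
  "lower_type_greater X l \<alpha> \<longleftrightarrow>
     (\<exists>\<alpha>0>\<alpha>. \<exists>c1. \<forall>x\<in>X. \<forall>s t. 0 < s \<and> s \<le> 1 \<and> 0 < t \<longrightarrow> l x (s * t) \<le> c1 * s powr \<alpha>0 * l x t)"

definition upper_doubling ::
    "'a set \<Rightarrow> ('a \<Rightarrow> 'a \<Rightarrow> real) \<Rightarrow> 'a measure \<Rightarrow> ('a \<Rightarrow> real \<Rightarrow> real) \<Rightarrow> bool" where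
  "upper_doubling X d M l \<longleftrightarrow>
     doubling_fun X l \<and> (\<forall>x\<in>X. mono_on {0<..} (l x)) \<and>
     (\<forall>x\<in>X. \<forall>r>0. emeasure M (qball X d x r) \<le> ennreal (l x r))"

text \<open>The modular and the Luxemburg norm take values in \<open>[0, \<infinity>]\<close>; the norm is \<open>\<infinity>\<close> when no
  \<open>t > 0\<close> qualifies.\<close>

definition var_modular :: "'a measure \<Rightarrow> ('a \<Rightarrow> real) \<Rightarrow> ('a \<Rightarrow> real) \<Rightarrow> ennreal" where
  "var_modular M q f = (\<integral>\<^sup>+x. ennreal (\<bar>f x\<bar> powr q x) \<partial>M)"

definition var_Lebesgue :: "'a measure \<Rightarrow> ('a \<Rightarrow> real) \<Rightarrow> ('a \<Rightarrow> real) set" where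
  "var_Lebesgue M q = {f \<in> borel_measurable M. var_modular M q f < \<infinity>}"

definition var_norm :: "'a measure \<Rightarrow> ('a \<Rightarrow> real) \<Rightarrow> ('a \<Rightarrow> real) \<Rightarrow> ennreal" where
  "var_norm M q f = (INF t\<in>{t::real. 0 < t \<and> var_modular M q (\<lambda>x. f x / t) \<le> 1}. ennreal t)"

definition Lebesgue_p :: "'a measure \<Rightarrow> real \<Rightarrow> ('a \<Rightarrow> real) set" where
  "Lebesgue_p M p = {f \<in> borel_measurable M. integrable M (\<lambda>x. \<bar>f x\<bar> powr p)}"

definition Lp_norm :: "'a measure \<Rightarrow> real \<Rightarrow> ('a \<Rightarrow> real) \<Rightarrow> real" where
  "Lp_norm M p f = (\<integral>x. \<bar>f x\<bar> powr p \<partial>M) powr (1 / p)"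

text \<open>On the diagonal the kernel is \<open>0 powr \<alpha> / l x 0 = 0\<close>, whatever \<open>l x 0\<close> is.\<close>

definition frac_kernel ::
    "('a \<Rightarrow> 'a \<Rightarrow> real) \<Rightarrow> ('a \<Rightarrow> real \<Rightarrow> real) \<Rightarrow> real \<Rightarrow> 'a \<Rightarrow> 'a \<Rightarrow> real" where
  "frac_kernel d l \<alpha> x y = d x y powr \<alpha> / l x (d x y)"

definition frac_integral ::
    "'a measure \<Rightarrow> ('a \<Rightarrow> 'a \<Rightarrow> real) \<Rightarrow> ('a \<Rightarrow> real \<Rightarrow> real) \<Rightarrow> real \<Rightarrow> ('a \<Rightarrow> real) \<Rightarrow> 'a \<Rightarrow> real" where
  "frac_integral M d l \<alpha> f x = (\<integral>y. frac_kernel d l \<alpha> x y * f y \<partial>M)"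

text \<open>Boundedness of the operator from \<open>L\<^sup>p\<close> to the variable Lebesgue space. Well-definedness is
  included: the defining integral converges absolutely for almost every \<open>x\<close> (the Bochner integral
  is \<open>0\<close> at the others). No measurability of \<open>l\<close> in its first argument is available, so
  \<open>frac_integral M d l \<alpha> f\<close> can fail to be measurable; membership in the variable Lebesgue space is
  therefore claimed whenever it is measurable, and the norm inequality always.\<close>

definition frac_integral_bounded ::
    "'a measure \<Rightarrow> ('a \<Rightarrow> 'a \<Rightarrow> real) \<Rightarrow> ('a \<Rightarrow> real \<Rightarrow> real) \<Rightarrow> real \<Rightarrow> real \<Rightarrow> ('a \<Rightarrow> real) \<Rightarrow> bool" where
  "frac_integral_bounded M d l \<alpha> p q \<longleftrightarrow>
     (\<exists>C\<ge>0. \<forall>f \<in> Lebesgue_p M p.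
        (AE x in M. integrable M (\<lambda>y. frac_kernel d l \<alpha> x y * f y)) \<and>
        (frac_integral M d l \<alpha> f \<in> borel_measurable M \<longrightarrow>
           frac_integral M d l \<alpha> f \<in> var_Lebesgue M q) \<and>
        var_norm M q (frac_integral M d l \<alpha> f) \<le> ennreal (C * Lp_norm M p f))"

end

theory Submission
  imports Defs
begin

text \<open>The proof is Hedberg's: the potential is bounded pointwise by a power of a maximal function, and the
maximal function is bounded on \<open>L\<^sup>p\<close>. The maximal function suited to a non-doubling measure is
\<open>\<M>f(x) = sup\<^bsub>r>0\<^esub> (\<integral>\<^bsub>B(x,r)\<^esub> \<bar>f\<bar> d\<mu>) / \<lambda>(x, \<kappa>r)\<close>,
in which the average is taken against \<open>\<lambda>(x, \<kappa>r) \<ge> \<mu>(B(x, \<kappa>r))\<close>, the mass of a dilated ball.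

Let \<open>\<parallel>f\<parallel>\<^sub>p = 1\<close> and cut the kernel into dyadic shells at a radius \<open>r\<close>. The shells inside \<open>B(x,r)\<close> contribute
at most a constant times \<open>r\<^sup>\<alpha> \<M>f(x)\<close>. On a shell of radius \<open>t \<ge> r\<close>, Hoelder's inequality and
\<open>\<mu>(B(x,t)) \<le> \<lambda>(x,t)\<close> leave \<open>t\<^sup>\<alpha> \<lambda>(x,t) powr (-1/p)\<close>, which the hypothesis relating \<open>r\<^sup>\<alpha>\<close> to \<open>\<lambda>\<close> turns into
\<open>\<lambda>(x,t) powr (-1/q(x))\<close>; since \<open>\<lambda>\<close> has positive lower type, the sum over the outer shells is at most
a constant times \<open>\<lambda>(x,r) powr (-1/q(x))\<close>. By the same hypothesis the inner part is at most
\<open>\<lambda>(x,r) powr (-1/q(x))\<close> times \<open>\<lambda>(x,r) powr (1/p) \<M>f(x)\<close>. With \<open>A = max 1 (\<M>f(x))\<close>, lower type and doubling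
provide an \<open>r\<close> with \<open>\<lambda>(x,r)\<close> comparable to \<open>A powr (-p)\<close>, and both parts are then at most a constant
times \<open>A powr (p/q(x))\<close>. Raised to the power \<open>q(x)\<close> this is a multiple of \<open>A powr p\<close>, which has bounded
integral because \<open>\<mu>\<close> is finite and the maximal operator is bounded on \<open>L\<^sup>p\<close> (\<open>hedberg\<close>,
\<open>frac_integral_majorant\<close>).

Since \<open>\<lambda>(x,r)\<close> is arbitrary as a function of \<open>x\<close>, both \<open>\<M>f\<close> and the potential can fail to be measurable.
The maximal theorem is therefore phrased through measurable majorants. The Vitali selection
(\<open>vitali_selection\<close>) places the superlevel set \<open>{\<M>f > t}\<close> inside a countable union of balls, a measurable
set \<open>G\<close> whose mass obeys the weak-type bound (\<open>maximal_weak_type\<close>). Applied at the level \<open>2\<^sup>n/2\<close> to the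
part of \<open>f\<close> above \<open>2\<^sup>n/2\<close>, it gives sets \<open>G\<^sub>n\<close> containing \<open>{\<M>f > 2\<^sup>n}\<close>, and
\<open>1 + (\<Sum>n. 2 powr (p * (n+1)) * indicator G\<^sub>n)\<close> is a measurable majorant of \<open>A powr p\<close> with controlled integral (\<open>maximal_strong_type\<close>). This is Marcinkiewicz
interpolation in discrete form.\<close>

section \<open>Vitali selection\<close>

text \<open>The generalized Vitali covering argument, stated for arbitrary nonempty sets with a bounded size
attached to each. Zorn's lemma is applied to the disjoint subfamilies that already satisfy the conclusion
for every member they meet; a maximal such subfamily must meet everything, since otherwise a nearly
largest missed member could be added.\<close>

lemma vitali_selection:
  fixes B :: "'i \<Rightarrow> 'b set" and r :: "'i \<Rightarrow> real"
  assumes ne: "\<And>i. i \<in> A \<Longrightarrow> B i \<noteq> {}"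
    and r: "\<And>i. i \<in> A \<Longrightarrow> 0 < r i \<and> r i \<le> R"
  shows "\<exists>S\<subseteq>A. disjoint_family_on B S \<and> (\<forall>i\<in>A. \<exists>j\<in>S. B i \<inter> B j \<noteq> {} \<and> r i \<le> 2 * r j)"
proof -
  define \<C> where "\<C> = {S. S \<subseteq> A \<and> disjoint_family_on B S \<and>
     (\<forall>i\<in>A. (\<exists>j\<in>S. B i \<inter> B j \<noteq> {}) \<longrightarrow> (\<exists>j\<in>S. B i \<inter> B j \<noteq> {} \<and> r i \<le> 2 * r j))}"
  have "\<exists>S\<in>\<C>. \<forall>T\<in>\<C>. S \<subseteq> T \<longrightarrow> T = S"
  proof (rule subset_Zorn')
    fix c assume c: "subset.chain \<C> c"
    then have sub: "c \<subseteq> \<C>" and lin: "\<And>S T. S \<in> c \<Longrightarrow> T \<in> c \<Longrightarrow> S \<subseteq> T \<or> T \<subseteq> S"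
      by (auto simp: subset_chain_def)
    have "disjoint_family_on B (\<Union>c)"
      unfolding disjoint_family_on_def
    proof (intro ballI impI)
      fix i j assume "i \<in> \<Union>c" "j \<in> \<Union>c" "i \<noteq> j"
      then obtain S where "S \<in> c" "i \<in> S" "j \<in> S" using lin by blast
      with sub \<open>i \<noteq> j\<close> show "B i \<inter> B j = {}"
        unfolding \<C>_def disjoint_family_on_def by blast
    qed
    with sub show "\<Union>c \<in> \<C>" unfolding \<C>_def by blast
  qed
  then obtain S where S: "S \<in> \<C>" and max: "\<And>T. T \<in> \<C> \<Longrightarrow> S \<subseteq> T \<Longrightarrow> T = S" by blast
  have hit: "\<exists>j\<in>S. B i \<inter> B j \<noteq> {}" if "i \<in> A" for i
  proof (rule ccontr)
    assume miss: "\<not> ?thesis"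
    \<comment> \<open>the members missed by the maximal subfamily; one of more than half their largest size is added\<close>
    define U where "U = {k \<in> A. \<forall>j\<in>S. B k \<inter> B j = {}}"
    have "i \<in> U" using miss that by (auto simp: U_def)
    have bdd: "bdd_above (r ` U)" using r by (auto simp: U_def bdd_above_def)
    have "r i \<le> Sup (r ` U)" using \<open>i \<in> U\<close> bdd by (auto intro: cSup_upper)
    then have "Sup (r ` U) / 2 < Sup (r ` U)" using r[OF that] by auto
    then have "\<exists>y\<in>r ` U. Sup (r ` U) / 2 < y"
      using less_cSup_iff[of "r ` U"] \<open>i \<in> U\<close> bdd by blast
    then obtain k where k: "k \<in> U" "Sup (r ` U) / 2 < r k" by blast
    have "insert k S \<in> \<C>"
      unfolding \<C>_def
    proof (intro CollectI conjI ballI impI)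
      show "insert k S \<subseteq> A" using S k by (auto simp: \<C>_def U_def)
      show "disjoint_family_on B (insert k S)"
        using S k by (auto simp: \<C>_def U_def disjoint_family_on_def)
      fix m assume "m \<in> A" "\<exists>j\<in>insert k S. B m \<inter> B j \<noteq> {}"
      then obtain j x where m: "m \<in> A" "j \<in> insert k S" "x \<in> B m" "x \<in> B j" by blast
      show "\<exists>j\<in>insert k S. B m \<inter> B j \<noteq> {} \<and> r m \<le> 2 * r j"
      proof (cases "m \<in> U")
        case True
        then have "r m \<le> Sup (r ` U)" using bdd by (auto intro: cSup_upper)
        moreover have "j = k" using m True by (auto simp: U_def)
        ultimately show ?thesis using k m by (intro bexI[of _ k]) auto
      next
        case False
        then show ?thesis using m S unfolding U_def \<C>_def by blast
      qed
    qed
    then have "insert k S = S" using max by blast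
    then have "B k \<inter> B k = {}" using k by (auto simp: U_def)
    then show False using ne k by (auto simp: U_def)
  qed
  show ?thesis
    using S hit by (intro exI[of _ S]) (auto simp: \<C>_def)
qed

lemma countable_disjoint_positive:
  assumes "finite_measure M"
    and [measurable]: "\<And>i. i \<in> S \<Longrightarrow> B i \<in> sets M"
    and disj: "disjoint_family_on B S"
    and pos: "\<And>i. i \<in> S \<Longrightarrow> 0 < measure M (B i)"
  shows "countable S"
proof -
  interpret finite_measure M by fact
  have "(\<lambda>i. measure M (B i)) summable_on S"
  proof (rule nonneg_bounded_partial_sums_imp_summable_on)
    show "\<forall>\<^sub>F F in finite_subsets_at_top S. (\<Sum>i\<in>F. measure M (B i)) \<le> measure M (space M)"
    proof (rule eventually_finite_subsets_at_top_weakI)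
      fix F assume F: "finite F" "F \<subseteq> S"
      then have "(\<Sum>i\<in>F. measure M (B i)) = measure M (\<Union>i\<in>F. B i)"
        using disjoint_family_on_mono[OF F(2) disj]
        by (subst finite_measure_finite_Union) auto
      also have "\<dots> \<le> measure M (space M)" by (rule bounded_measure)
      finally show "(\<Sum>i\<in>F. measure M (B i)) \<le> measure M (space M)" .
    qed
  qed auto
  from summable_countable_real[OF this] show ?thesis
    using pos by (force elim!: countable_subset[rotated])
qed

section \<open>Bounded spaces with an upper doubling measure\<close>

text \<open>The setting of the maximal theorem. The measure is meant to be the completion of a Borel measure on a
bounded space, which is why it is finite and why its relation to the topology is expressed by the
measurability of the balls.\<close>

locale upper_doubling_space = quasi_metric X d + N: finite_measure N
  for X :: "'a set" and d and N :: "'a measure" +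
  fixes l :: "'a \<Rightarrow> real \<Rightarrow> real"
  assumes space_N: "space N = X"
    and ball_sets [measurable]: "\<And>x r. x \<in> X \<Longrightarrow> qball X d x r \<in> sets N"
    and bounded: "qbounded d X"
    and l_pos: "\<And>x r. x \<in> X \<Longrightarrow> 0 < r \<Longrightarrow> 0 < l x r"
    and l_mono: "\<And>x r s. x \<in> X \<Longrightarrow> 0 < r \<Longrightarrow> r \<le> s \<Longrightarrow> l x r \<le> l x s"
    and l_doubling: "doubling_fun X l"
    and ball_le: "\<And>x r. x \<in> X \<Longrightarrow> 0 < r \<Longrightarrow> emeasure N (qball X d x r) \<le> ennreal (l x r)"
begin

lemma l_dilation:
  assumes "0 < \<kappa>"
  obtains C where "1 \<le> C" "\<And>x r. x \<in> X \<Longrightarrow> 0 < r \<Longrightarrow> l x (\<kappa> * r) \<le> C * l x r"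
proof -
  obtain C0 where C0: "\<And>x r. x \<in> X \<Longrightarrow> 0 < r \<Longrightarrow> l x (2 * r) \<le> C0 * l x r"
    using l_doubling by (auto simp: doubling_fun_def)
  define C where "C = max 1 C0"
  have C: "1 \<le> C" by (simp add: C_def)
  have step: "l x (2 * r) \<le> C * l x r" if "x \<in> X" "0 < r" for x r
    using C0[OF that] l_pos[OF that] mult_right_mono[of C0 C "l x r"]
    unfolding C_def by linarith
  have pow: "l x (2 ^ n * r) \<le> C ^ n * l x r" if "x \<in> X" "0 < r" for x r n
  proof (induction n)
    case (Suc n)
    have "l x (2 ^ Suc n * r) \<le> C * l x (2 ^ n * r)"
      using step[of x "2 ^ n * r"] that by (simp add: mult.assoc)
    also have "\<dots> \<le> C * (C ^ n * l x r)"
      using Suc C by (intro mult_left_mono) auto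
    finally show ?case by (simp add: mult.assoc)
  qed simp
  obtain n where n: "\<kappa> < 2 ^ n" using real_arch_pow[of 2 \<kappa>] by auto
  show thesis
  proof (rule that[of "C ^ n"])
    show "1 \<le> C ^ n" using C by simp
    fix x r assume x: "x \<in> X" "0 < (r::real)"
    have "l x (\<kappa> * r) \<le> l x (2 ^ n * r)"
      using n x assms by (intro l_mono) auto
    also have "\<dots> \<le> C ^ n * l x r" by (rule pow[OF x])
    finally show "l x (\<kappa> * r) \<le> C ^ n * l x r" .
  qed
qed

text \<open>The weak-type \<open>(1,1)\<close> inequality for the maximal function. Each point of the superlevel set is the centre
of a ball on which \<open>h\<close> is large compared with \<open>l x (\<kappa> * r)\<close>. From these balls a disjoint
subfamily is selected whose \<open>\<kappa>\<close>-dilates contain all centres, and the mass of a dilate is dominated by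
\<open>l x (\<kappa> * r)\<close>, hence, up to the factor \<open>t\<close>, by the integral of \<open>h\<close> over the undilated ball. The
dilation sits in the denominator of the maximal function because the mass of a dilate is not
controlled by that of the ball.\<close>

lemma maximal_weak_type:
  obtains \<kappa> where "1 \<le> \<kappa>"
    "\<And>h t. h \<in> borel_measurable N \<Longrightarrow> 0 < t \<Longrightarrow>
       \<exists>G\<in>sets N. {x \<in> X. \<exists>r>0. ennreal (t * l x (\<kappa> * r)) < (\<integral>\<^sup>+y\<in>qball X d x r. h y \<partial>N)} \<subseteq> G
         \<and> ennreal t * emeasure N G \<le> (\<integral>\<^sup>+y. h y \<partial>N)"
proof -
  obtain K where K: "0 < K" "\<And>x y z. x \<in> X \<Longrightarrow> y \<in> X \<Longrightarrow> z \<in> X \<Longrightarrow> d x y \<le> K * (d x z + d z y)"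
    using quasi_triangle by blast
  obtain D where D: "\<And>x y. x \<in> X \<Longrightarrow> y \<in> X \<Longrightarrow> d x y \<le> D"
    using bounded by (auto simp: qbounded_def)
  \<comment> \<open>balls of radius \<open>R\<close> are the whole space, so radii may be capped at \<open>R\<close>, as the selection requires\<close>
  define R where "R = \<bar>D\<bar> + 1"
  \<comment> \<open>a centre whose ball of radius at most \<open>2 * r\<close> meets a ball of radius \<open>r\<close> is within \<open>K * (2 * r + r)\<close> of its centre\<close>
  define \<kappa> where "\<kappa> = max 1 (3 * K)"
  have R: "0 < R" by (simp add: R_def)
  have whole: "qball X d x R = X" if "x \<in> X" for x
    using D that by (fastforce simp: qball_def R_def)
  have \<kappa>: "1 \<le> \<kappa>" by (simp add: \<kappa>_def)
  show thesis
  proof (rule that[OF \<kappa>])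
    fix h :: "'a \<Rightarrow> ennreal" and t :: real
    assume h[measurable]: "h \<in> borel_measurable N" and t: "0 < t"
    define E where "E = {x \<in> X. \<exists>r>0. ennreal (t * l x (\<kappa> * r)) < (\<integral>\<^sup>+y\<in>qball X d x r. h y \<partial>N)}"
    show "\<exists>G\<in>sets N. E \<subseteq> G \<and> ennreal t * emeasure N G \<le> (\<integral>\<^sup>+y. h y \<partial>N)"
    proof (cases "(\<integral>\<^sup>+y. h y \<partial>N) = \<infinity>")
      case True
      then show ?thesis using space_N by (intro bexI[of _ "space N"]) (auto simp: E_def)
    next
      case False
      define \<nu> where "\<nu> = density N h"
      have \<nu>: "emeasure \<nu> A = (\<integral>\<^sup>+y\<in>A. h y \<partial>N)" if "A \<in> sets N" for A
        using that by (simp add: \<nu>_def emeasure_density)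
      have sets_\<nu>: "sets \<nu> = sets N" by (simp add: \<nu>_def)
      have tot: "emeasure \<nu> (space \<nu>) = (\<integral>\<^sup>+y. h y \<partial>N)"
        using \<nu>[of "space N"] by (simp add: \<nu>_def cong: nn_integral_cong)
      interpret \<nu>: finite_measure \<nu>
        using False tot by (intro finite_measureI) auto
      have "\<exists>r. 0 < r \<and> r \<le> R \<and> ennreal (t * l x (\<kappa> * r)) < emeasure \<nu> (qball X d x r)"
        if "x \<in> E" for x
      proof -
        obtain r where x: "x \<in> X" and r: "0 < r"
          and big: "ennreal (t * l x (\<kappa> * r)) < emeasure \<nu> (qball X d x r)"
          using \<nu> ball_sets \<open>x \<in> E\<close> by (auto simp: E_def)
        show ?thesis
        proof (cases "r \<le> R")
          case False
          have "qball X d x r = qball X d x R"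
            using whole[OF x] False by (force simp: qball_def)
          moreover have "ennreal (t * l x (\<kappa> * R)) \<le> ennreal (t * l x (\<kappa> * r))"
            using l_mono[OF x, of "\<kappa> * R" "\<kappa> * r"] \<kappa> R False t by (intro ennreal_leI) auto
          ultimately show ?thesis
            using big R by (intro exI[of _ R]) (auto intro: le_less_trans)
        qed (use big r in auto)
      qed
      then obtain r where r: "\<And>x. x \<in> E \<Longrightarrow> 0 < r x \<and> r x \<le> R"
        and big: "\<And>x. x \<in> E \<Longrightarrow> ennreal (t * l x (\<kappa> * r x)) < emeasure \<nu> (qball X d x (r x))"
        by metis
      have EX: "E \<subseteq> X" by (auto simp: E_def)
      have ctr: "x \<in> qball X d x s" if "x \<in> X" "0 < s" for x s
        using that zero_iff[of x x] by (simp add: qball_def)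
      have ne: "\<And>x. x \<in> E \<Longrightarrow> qball X d x (r x) \<noteq> {}" using r ctr EX by blast
      have "\<exists>S\<subseteq>E. disjoint_family_on (\<lambda>x. qball X d x (r x)) S \<and>
          (\<forall>x\<in>E. \<exists>y\<in>S. qball X d x (r x) \<inter> qball X d y (r y) \<noteq> {} \<and> r x \<le> 2 * r y)"
        by (rule vitali_selection[of E "\<lambda>x. qball X d x (r x)" r R, OF ne r])
      then obtain S where S: "S \<subseteq> E" "disjoint_family_on (\<lambda>x. qball X d x (r x)) S"
        and cover: "\<forall>x\<in>E. \<exists>y\<in>S. qball X d x (r x) \<inter> qball X d y (r y) \<noteq> {} \<and> r x \<le> 2 * r y"
        by (elim exE conjE)
      have SX: "S \<subseteq> X" using S EX by auto
      have B[measurable]: "\<And>x s. x \<in> S \<Longrightarrow> qball X d x s \<in> sets N" using SX by auto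
      \<comment> \<open>each selected ball has positive \<open>\<nu>\<close>-mass, because \<open>l\<close> is positive\<close>
      have cS: "countable S"
      proof (rule countable_disjoint_positive[OF \<nu>.finite_measure_axioms _ S(2)])
        show "0 < measure \<nu> (qball X d x (r x))" if "x \<in> S" for x
          using big[of x] S that \<nu>.emeasure_eq_measure[of "qball X d x (r x)"]
          by (auto simp: le_less_trans zero_less_measure_iff)
      qed (use sets_\<nu> in auto)
      define G where "G = (\<Union>y\<in>S. qball X d y (\<kappa> * r y))"
      have G[measurable]: "G \<in> sets N" unfolding G_def using cS by auto
      have "E \<subseteq> G"
      proof
        fix x assume x: "x \<in> E"
        obtain y w where y: "y \<in> S" "r x \<le> 2 * r y" and w: "w \<in> X" "d w x < r x" "d w y < r y"
          using bspec[OF cover x] by (auto simp: qball_def)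
        have X: "x \<in> X" "y \<in> X" using x y SX EX by auto
        have "d x y \<le> K * (d x w + d w y)" using K X w by auto
        also have "\<dots> < K * (3 * r y)"
          using K w y X commute[of w x] by (intro mult_strict_left_mono) auto
        also have "\<dots> \<le> \<kappa> * r y"
          using r[of y] y S by (auto simp: \<kappa>_def intro!: mult_right_mono)
        finally show "x \<in> G" using X y by (auto simp: G_def qball_def)
      qed
      moreover have "ennreal t * emeasure N G \<le> (\<integral>\<^sup>+y. h y \<partial>N)"
      proof -
        have "emeasure N G = (\<integral>\<^sup>+z. indicator G z \<partial>N)" by simp
        also have "\<dots> \<le> (\<integral>\<^sup>+z. \<integral>\<^sup>+y. indicator (qball X d y (\<kappa> * r y)) z \<partial>count_space S \<partial>N)"
        proof (rule nn_integral_mono)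
          fix z
          show "indicator G z \<le> (\<integral>\<^sup>+y. indicator (qball X d y (\<kappa> * r y)) z \<partial>count_space S)"
          proof (cases "z \<in> G")
            case True
            then obtain y where y: "y \<in> S" "z \<in> qball X d y (\<kappa> * r y)" by (auto simp: G_def)
            have "(1::ennreal) = (\<integral>\<^sup>+y'. indicator {y} y' \<partial>count_space S)"
              using y by simp
            also have "\<dots> \<le> (\<integral>\<^sup>+y. indicator (qball X d y (\<kappa> * r y)) z \<partial>count_space S)"
              using y by (intro nn_integral_mono) (auto split: split_indicator)
            finally show ?thesis using True by simp
          qed simp
        qed
        also have "\<dots> = (\<integral>\<^sup>+y. emeasure N (qball X d y (\<kappa> * r y)) \<partial>count_space S)"
          using cS by (subst nn_integral_count_space_nn_integral) (auto intro!: nn_integral_cong)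
        finally have "ennreal t * emeasure N G
            \<le> ennreal t * (\<integral>\<^sup>+y. emeasure N (qball X d y (\<kappa> * r y)) \<partial>count_space S)"
          by (rule mult_left_mono) simp
        also have "\<dots> = (\<integral>\<^sup>+y. ennreal t * emeasure N (qball X d y (\<kappa> * r y)) \<partial>count_space S)"
          by (subst nn_integral_cmult) auto
        also have "\<dots> \<le> (\<integral>\<^sup>+y. emeasure \<nu> (qball X d y (r y)) \<partial>count_space S)"
        proof (rule nn_integral_mono)
          fix y assume "y \<in> space (count_space S)"
          then have y: "y \<in> E" "y \<in> X" using S SX by auto
          have "ennreal t * emeasure N (qball X d y (\<kappa> * r y)) \<le> ennreal t * ennreal (l y (\<kappa> * r y))"
            using ball_le[OF y(2), of "\<kappa> * r y"] r[OF y(1)] \<kappa> by (intro mult_left_mono) auto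
          also have "\<dots> \<le> emeasure \<nu> (qball X d y (r y))"
            using big[OF y(1)] t by (simp add: ennreal_mult'[symmetric])
          finally show "ennreal t * emeasure N (qball X d y (\<kappa> * r y)) \<le> emeasure \<nu> (qball X d y (r y))" .
        qed
        also have "\<dots> = emeasure \<nu> (\<Union>y\<in>S. qball X d y (r y))"
          using cS S sets_\<nu> by (subst emeasure_UN_countable) auto
        also have "\<dots> \<le> emeasure \<nu> (space \<nu>)" by (rule emeasure_space)
        finally show ?thesis unfolding tot .
      qed
      ultimately show ?thesis by (intro bexI[OF _ G] conjI)
    qed
  qed
qed

end

section \<open>The maximal theorem\<close>

lemma ennreal_suminf_le_const:
  fixes f :: "nat \<Rightarrow> real"
  assumes "\<And>n. 0 \<le> f n" "\<And>m. (\<Sum>n<m. f n) \<le> c"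
  shows "(\<Sum>n. ennreal (f n)) \<le> ennreal c"
proof -
  have "(\<Sum>n<m. ennreal (f n)) \<le> ennreal c" for m
    unfolding sum_ennreal[of "{..<m}" f, OF assms(1)] by (rule ennreal_leI) (rule assms(2))
  then have "(\<Sum>n. ennreal (f n)) + 0 \<le> ennreal c"
    by (intro ennreal_suminf_bound_add) (simp only: add_0_right)
  then show ?thesis by (simp only: add_0_right)
qed

lemma ennreal_term_le_suminf: "(f :: nat \<Rightarrow> ennreal) m \<le> (\<Sum>n. f n)"
  using sum_le_suminf[OF summableI, of "{m}" f] by simp

text \<open>A geometric series of ratio \<open>2 powr (p - 1)\<close> cut off at \<open>2 ^ n < v\<close> is comparable with its last term.
The partial sums are bounded uniformly in \<open>m\<close>: they stop growing once \<open>2 ^ m\<close> reaches \<open>v\<close>.\<close>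

lemma dyadic_sum_le:
  fixes p v :: real
  assumes p: "1 < p" and v: "0 \<le> v"
  shows "(\<Sum>n<m. if 2 ^ n < v then (2 powr (p - 1)) ^ n else 0)
    \<le> 2 powr (p - 1) / (2 powr (p - 1) - 1) * v powr (p - 1)"
proof (induction m)
  case 0
  show ?case using p by (auto intro!: divide_nonneg_nonneg mult_nonneg_nonneg ge_one_powr_ge_zero)
next
  case (Suc m)
  define b :: real where "b = 2 powr (p - 1)"
  have b: "1 < b" using p by (simp add: b_def)
  show ?case
  proof (cases "2 ^ m < v")
    case True
    have "(\<Sum>n<Suc m. if 2 ^ n < v then b ^ n else 0) \<le> (\<Sum>n<Suc m. b ^ n)"
      using b by (intro sum_mono) auto
    also have "\<dots> = (b ^ Suc m - 1) / (b - 1)"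
      using b by (simp only: geometric_sum)
    also have "\<dots> \<le> b / (b - 1) * b ^ m"
      using b by (simp add: divide_right_mono)
    also have "b ^ m = (2 ^ m) powr (p - 1)"
      by (simp add: b_def powr_powr powr_realpow[symmetric] mult.commute)
    also have "b / (b - 1) * (2 ^ m) powr (p - 1) \<le> b / (b - 1) * v powr (p - 1)"
      using b p True by (intro mult_left_mono powr_mono2) auto
    finally show ?thesis unfolding b_def .
  qed (use Suc in \<open>simp add: b_def\<close>)
qed

context upper_doubling_space
begin

text \<open>The strong-type inequality, expressed by a measurable majorant \<open>g\<close> of the \<open>p\<close>-th power of \<open>max 1\<close> of
the maximal function; \<open>A\<close> plays the part of the latter, and \<open>g\<close> is infinite where the maximal function
is. Above the level \<open>2 ^ n\<close> only the part of \<open>f\<close> larger than \<open>2 ^ n / 2\<close> matters, since the rest has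
averages at most \<open>2 ^ n / 2\<close>. Summing the weak-type bounds for these parts and exchanging sum and
integral leaves, at each point, a truncated geometric series comparable with \<open>f y powr (p - 1)\<close>.
Levels below \<open>1\<close> are absorbed by the constant function \<open>1\<close>, which the finite measure integrates.\<close>

lemma maximal_strong_type:
  assumes p: "1 < p"
  obtains \<kappa> C where "1 \<le> \<kappa>" "0 \<le> C"
    "\<And>f. f \<in> borel_measurable N \<Longrightarrow> (\<And>y. 0 \<le> f y) \<Longrightarrow> (\<integral>\<^sup>+y. ennreal (f y powr p) \<partial>N) \<le> 1 \<Longrightarrow>
       \<exists>g\<in>borel_measurable N. (\<integral>\<^sup>+x. g x \<partial>N) \<le> ennreal C \<and>
         (\<forall>x\<in>X. g x \<noteq> \<infinity> \<longrightarrow> (\<exists>A\<ge>1. ennreal (A powr p) \<le> g x \<and>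
            (\<forall>r>0. (\<integral>\<^sup>+y\<in>qball X d x r. ennreal (f y) \<partial>N) \<le> ennreal (l x (\<kappa> * r) * A))))"
proof -
  obtain \<kappa> where \<kappa>: "1 \<le> \<kappa>" and weak: "\<And>h t. h \<in> borel_measurable N \<Longrightarrow> 0 < t \<Longrightarrow>
       \<exists>G\<in>sets N. {x \<in> X. \<exists>r>0. ennreal (t * l x (\<kappa> * r)) < (\<integral>\<^sup>+y\<in>qball X d x r. h y \<partial>N)} \<subseteq> G
         \<and> ennreal t * emeasure N G \<le> (\<integral>\<^sup>+y. h y \<partial>N)"
    by (rule maximal_weak_type) blast
  define b :: real where "b = 2 powr (p - 1)"
  define b' :: real where "b' = 2 powr p"
  have b: "1 < b" using p by (simp add: b_def)
  have b': "b' = 2 * b" by (simp add: b_def b'_def powr_diff)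
  have b'1: "1 < b'" using b b' by simp
  define c where "c = 2 * b' * (b / (b - 1)) * b"
  have c: "0 \<le> c" using b b' by (simp add: c_def)
  have nonneg: "0 \<le> measure N X + c" using c by simp
  have main: "\<exists>g\<in>borel_measurable N. (\<integral>\<^sup>+x. g x \<partial>N) \<le> ennreal (measure N X + c) \<and>
         (\<forall>x\<in>X. g x \<noteq> \<infinity> \<longrightarrow> (\<exists>A\<ge>1. ennreal (A powr p) \<le> g x \<and>
            (\<forall>r>0. (\<integral>\<^sup>+y\<in>qball X d x r. ennreal (f y) \<partial>N) \<le> ennreal (l x (\<kappa> * r) * A))))"
    if [measurable]: "f \<in> borel_measurable N" and f0: "\<And>y. 0 \<le> f y"
      and norm: "(\<integral>\<^sup>+y. ennreal (f y powr p) \<partial>N) \<le> 1" for f :: "'a \<Rightarrow> real"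
  proof -
    define h where "h n y = ennreal (if 2 ^ n < 2 * f y then f y else 0)" for n :: nat and y
    have [measurable]: "h n \<in> borel_measurable N" for n unfolding h_def by measurable
    define bad where "bad n = {x \<in> X. \<exists>r>0. ennreal (2 ^ n / 2 * l x (\<kappa> * r)) < (\<integral>\<^sup>+y\<in>qball X d x r. h n y \<partial>N)}"
      for n
    have "\<forall>n. \<exists>G. G \<in> sets N \<and> bad n \<subseteq> G \<and> ennreal (2 ^ n / 2) * emeasure N G \<le> (\<integral>\<^sup>+y. h n y \<partial>N)"
      using weak[of "h n" "2 ^ n / 2" for n] unfolding bad_def Bex_def by simp
    from choice[OF this] obtain G where G[measurable]: "\<And>n. G n \<in> sets N"
      and sub: "\<And>n. bad n \<subseteq> G n"
      and meas: "\<And>n. ennreal (2 ^ n / 2) * emeasure N (G n) \<le> (\<integral>\<^sup>+y. h n y \<partial>N)"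
      by blast
    have out: "(\<integral>\<^sup>+y\<in>qball X d x r. ennreal (f y) \<partial>N) \<le> ennreal (l x (\<kappa> * r) * 2 ^ n)"
      if x: "x \<in> X" "x \<notin> G n" and r: "0 < r" for x n r
    proof -
      have [measurable]: "qball X d x r \<in> sets N" using x by simp
      have small: "(\<integral>\<^sup>+y\<in>qball X d x r. h n y \<partial>N) \<le> ennreal (2 ^ n / 2 * l x (\<kappa> * r))"
        using sub[of n] x r unfolding bad_def by (blast intro: leI)
      have "(\<integral>\<^sup>+y\<in>qball X d x r. ennreal (f y) \<partial>N)
          \<le> (\<integral>\<^sup>+y. ennreal (2 ^ n / 2) * indicator (qball X d x r) y
                + h n y * indicator (qball X d x r) y \<partial>N)"
        using f0 by (intro nn_integral_mono)
          (auto simp: h_def split: split_indicator intro!: ennreal_leI simp flip: ennreal_plus)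
      also have "\<dots> = ennreal (2 ^ n / 2) * emeasure N (qball X d x r)
                + (\<integral>\<^sup>+y\<in>qball X d x r. h n y \<partial>N)"
        by (subst nn_integral_add) (auto simp: nn_integral_cmult_indicator)
      also have "\<dots> \<le> ennreal (2 ^ n / 2) * ennreal (l x (\<kappa> * r)) + ennreal (2 ^ n / 2 * l x (\<kappa> * r))"
      proof (intro add_mono mult_left_mono small)
        show "emeasure N (qball X d x r) \<le> ennreal (l x (\<kappa> * r))"
          using ball_le[OF x(1) r] l_mono[OF x(1) r, of "\<kappa> * r"] \<kappa> r
          by (auto intro: order_trans ennreal_leI)
      qed simp
      also have "\<dots> = ennreal (l x (\<kappa> * r) * 2 ^ n)"
        using l_pos[OF x(1), of "\<kappa> * r"] \<kappa> r
        by (simp add: ennreal_mult[symmetric] ennreal_plus[symmetric] del: ennreal_plus)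
      finally show ?thesis .
    qed
    \<comment> \<open>the exponent is \<open>Suc n\<close> because a point whose first missed set is \<open>G (Suc n)\<close> gets \<open>A = 2 ^ Suc n\<close>\<close>
    define g where "g x = 1 + (\<Sum>n. ennreal (b' ^ Suc n) * indicator (G n) x)" for x
    have [measurable]: "g \<in> borel_measurable N" 
      unfolding g_def by (intro borel_measurable_add borel_measurable_suminf_order borel_measurable_times) auto
    show ?thesis
    proof (intro bexI[of _ g] conjI ballI impI)
      have level: "ennreal (b' ^ Suc n) * emeasure N (G n)
          \<le> (\<integral>\<^sup>+y. ennreal (2 * b' * f y * (if 2 ^ n < 2 * f y then b ^ n else 0)) \<partial>N)" for n
      proof -
        have "b' ^ Suc n = 2 * b' * b ^ n * (2 ^ n / 2)" by (simp add: b' power_mult_distrib)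
        then have "ennreal (b' ^ Suc n) = ennreal (2 * b' * b ^ n) * ennreal (2 ^ n / 2)"
          using b b' by (simp add: ennreal_mult' [symmetric] ennreal_mult''[symmetric])
        then have "ennreal (b' ^ Suc n) * emeasure N (G n)
            = ennreal (2 * b' * b ^ n) * (ennreal (2 ^ n / 2) * emeasure N (G n))"
          by (simp only: mult.assoc)
        also have "\<dots> \<le> ennreal (2 * b' * b ^ n) * (\<integral>\<^sup>+y. h n y \<partial>N)"
          by (intro mult_left_mono meas) simp
        also have "\<dots> = (\<integral>\<^sup>+y. ennreal (2 * b' * b ^ n) * h n y \<partial>N)"
          by (subst nn_integral_cmult) auto
        also have "\<dots> = (\<integral>\<^sup>+y. ennreal (2 * b' * f y * (if 2 ^ n < 2 * f y then b ^ n else 0)) \<partial>N)"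
          using b b' f0 by (intro nn_integral_cong) (auto simp: h_def ennreal_mult[symmetric] mult_ac)
        finally show ?thesis .
      qed
      have pw: "(\<Sum>n. ennreal (2 * b' * f y * (if 2 ^ n < 2 * f y then b ^ n else 0)))
          \<le> ennreal (c * f y powr p)" for y
      proof (rule ennreal_suminf_le_const)
        show "0 \<le> 2 * b' * f y * (if 2 ^ n < 2 * f y then b ^ n else 0)" for n
          using b b' f0 by auto
        fix m :: nat
        have dyadic: "(\<Sum>n<m. if 2 ^ n < 2 * f y then b ^ n else 0) \<le> b / (b - 1) * (2 * f y) powr (p - 1)"
          using dyadic_sum_le[OF p, of "2 * f y" m] f0[of y] unfolding b_def by simp
        have "(\<Sum>n<m. 2 * b' * f y * (if 2 ^ n < 2 * f y then b ^ n else 0))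
            = 2 * b' * f y * (\<Sum>n<m. if 2 ^ n < 2 * f y then b ^ n else 0)"
          by (simp add: sum_distrib_left)
        also have "\<dots> \<le> 2 * b' * f y * (b / (b - 1) * (2 * f y) powr (p - 1))"
          using f0[of y] b b' by (intro mult_left_mono[OF dyadic]) auto
        also have "(2 * f y) powr (p - 1) = b * f y powr (p - 1)"
          using f0[of y] by (simp add: powr_mult b_def)
        also have "2 * b' * f y * (b / (b - 1) * (b * f y powr (p - 1))) = c * (f y * f y powr (p - 1))"
          by (simp only: c_def mult_ac)
        also have "f y * f y powr (p - 1) = f y powr p"
          using f0[of y] by (cases "f y = 0") (auto simp: powr_diff)
        finally show "(\<Sum>n<m. 2 * b' * f y * (if 2 ^ n < 2 * f y then b ^ n else 0)) \<le> c * f y powr p" .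
      qed
      have "(\<integral>\<^sup>+x. g x \<partial>N) = emeasure N X + (\<Sum>n. ennreal (b' ^ Suc n) * emeasure N (G n))"
        unfolding g_def space_N[symmetric]
        by (subst nn_integral_add) (auto simp: nn_integral_suminf nn_integral_cmult_indicator)
      also have "\<dots> \<le> emeasure N X +
          (\<Sum>n. \<integral>\<^sup>+y. ennreal (2 * b' * f y * (if 2 ^ n < 2 * f y then b ^ n else 0)) \<partial>N)"
        by (intro add_left_mono suminf_le level) auto
      also have "\<dots> = emeasure N X +
          (\<integral>\<^sup>+y. (\<Sum>n. ennreal (2 * b' * f y * (if 2 ^ n < 2 * f y then b ^ n else 0))) \<partial>N)"
        by (subst nn_integral_suminf) auto
      also have "\<dots> \<le> emeasure N X + (\<integral>\<^sup>+y. ennreal c * ennreal (f y powr p) \<partial>N)"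
        using pw c by (intro add_left_mono nn_integral_mono) (simp add: ennreal_mult'')
      also have "\<dots> = emeasure N X + ennreal c * (\<integral>\<^sup>+y. ennreal (f y powr p) \<partial>N)"
        by (subst nn_integral_cmult) auto
      also have "\<dots> \<le> emeasure N X + ennreal c * 1"
        by (intro add_left_mono mult_left_mono norm) simp
      also have "\<dots> = ennreal (measure N X + c)"
        using c by (simp add: N.emeasure_eq_measure)
      finally show "(\<integral>\<^sup>+x. g x \<partial>N) \<le> ennreal (measure N X + c)" .
    next
      fix x assume x: "x \<in> X" and fin: "g x \<noteq> \<infinity>"
      \<comment> \<open>a point of every \<open>G n\<close> would make the divergent geometric series a summand of \<open>g x\<close>\<close>
      have "\<exists>n. x \<notin> G n"
      proof (rule ccontr)
        assume "\<not> ?thesis"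
        then have "g x = 1 + (\<Sum>n. ennreal (b' ^ Suc n))" by (simp add: g_def)
        then have "(\<Sum>n. ennreal (b' ^ Suc n)) \<noteq> top" using fin by auto
        then have "summable (\<lambda>n. b' ^ Suc n)"
          using b'1 by (intro summable_suminf_not_top) simp
        then have "summable (\<lambda>n. b' ^ n)" by (subst (asm) summable_Suc_iff)
        then show False using b'1 by (simp add: summable_geometric_iff)
      qed
      then have "\<exists>n. x \<notin> G n \<and> (\<forall>m<n. \<not> x \<notin> G m)" by (rule exists_least_iff[THEN iffD1])
      then obtain n where n: "x \<notin> G n" and least: "\<And>m. m < n \<Longrightarrow> x \<in> G m" by blast
      have large: "ennreal ((2 ^ n) powr p) \<le> g x"
      proof (cases n)
        case 0
        then show ?thesis by (simp add: g_def)
      next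
        case (Suc m)
        have "(2 ^ n) powr p = b' ^ n"
          by (simp add: b'_def powr_powr powr_realpow[symmetric] mult.commute)
        then have "ennreal ((2 ^ n) powr p) = ennreal (b' ^ Suc m) * indicator (G m) x"
          using least[of m] Suc by (simp del: power_Suc)
        also have "\<dots> \<le> (\<Sum>n. ennreal (b' ^ Suc n) * indicator (G n) x)"
          by (rule ennreal_term_le_suminf)
        also have "\<dots> \<le> g x" unfolding g_def by (rule add_increasing) auto
        finally show ?thesis .
      qed
      show "\<exists>A\<ge>1. ennreal (A powr p) \<le> g x \<and>
            (\<forall>r>0. (\<integral>\<^sup>+y\<in>qball X d x r. ennreal (f y) \<partial>N) \<le> ennreal (l x (\<kappa> * r) * A))"
        by (intro exI[of _ "2 ^ n"] conjI allI impI large out[OF x n]) auto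
    qed simp
  qed
  show thesis by (rule that[OF \<kappa> nonneg], rule main)
qed

end

section \<open>Pointwise bounds for the potential\<close>

text \<open>A weighted Young inequality that takes the place of Hoelder's: integrated over a set of mass at
most \<open>b\<close>, for \<open>u\<close> of unit \<open>L\<^sup>p\<close> norm and with \<open>s = b powr (- 1 / p)\<close>, both terms on the right become
\<open>b powr (1 - 1 / p)\<close>.\<close>

lemma powr_young:
  fixes s u p :: real
  assumes "0 < s" "0 \<le> u" "1 < p"
  shows "u \<le> s + s powr (1 - p) * u powr p"
proof (cases "u \<le> s")
  case False
  then have "u powr (1 - p) \<le> s powr (1 - p)"
    using assms by (intro powr_mono2') auto
  then have "u powr (1 - p) * u powr p \<le> s powr (1 - p) * u powr p"
    by (intro mult_right_mono) auto
  moreover have "u powr (1 - p) * u powr p = u"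
    using False assms by (simp add: powr_add[symmetric])
  ultimately show ?thesis using assms by linarith
qed (use assms in \<open>simp add: add_increasing2\<close>)

lemma dyadic_shell:
  fixes \<delta> r :: real
  assumes "0 < \<delta>" "0 < r"
  shows "(\<exists>n. r / 2 ^ Suc n \<le> \<delta> \<and> \<delta> < 2 * (r / 2 ^ Suc n)) \<or> (\<exists>n. r * 2 ^ n \<le> \<delta> \<and> \<delta> < 2 * (r * 2 ^ n))"
proof (cases "\<delta> < r")
  case True
  obtain n0 where "r / \<delta> < 2 ^ n0" using real_arch_pow[of 2 "r / \<delta>"] by auto
  then have "\<exists>n. r / 2 ^ n \<le> \<delta>"
    using assms by (intro exI[of _ n0]) (simp add: field_simps)
  then have "\<exists>n. r / 2 ^ n \<le> \<delta> \<and> (\<forall>m<n. \<not> r / 2 ^ m \<le> \<delta>)" by (rule exists_least_iff[THEN iffD1])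
  then obtain n where n: "r / 2 ^ n \<le> \<delta>" "\<And>m. m < n \<Longrightarrow> \<delta> < r / 2 ^ m" by (auto simp: not_le)
  then obtain m where "n = Suc m" using True by (cases n) auto
  then show ?thesis using n(1) n(2)[of m] by auto
next
  case False
  obtain n0 where "\<delta> / r < 2 ^ n0" using real_arch_pow[of 2 "\<delta> / r"] by auto
  then have "\<exists>n. \<delta> < r * 2 ^ n"
    using assms by (intro exI[of _ n0]) (simp add: field_simps)
  then have "\<exists>n. \<delta> < r * 2 ^ n \<and> (\<forall>m<n. \<not> \<delta> < r * 2 ^ m)" by (rule exists_least_iff[THEN iffD1])
  then obtain n where n: "\<delta> < r * 2 ^ n" "\<And>m. m < n \<Longrightarrow> r * 2 ^ m \<le> \<delta>" by (auto simp: not_less)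
  then obtain m where "n = Suc m" using False by (cases n) auto
  then show ?thesis using n(1) n(2)[of m] by (auto intro!: exI[of _ m])
qed

context upper_doubling_space
begin

lemma dist_measurable [measurable]:
  assumes "x \<in> X"
  shows "d x \<in> borel_measurable N"
  unfolding borel_measurable_iff_less
proof
  fix a
  have "{y \<in> space N. d x y < a} = qball X d x a"
    using assms commute by (auto simp: space_N qball_def)
  then show "{y \<in> space N. d x y < a} \<in> sets N" using ball_sets[OF assms] by simp
qed

text \<open>In its second variable the kernel is a Borel function of the distance, because \<open>l x\<close> is monotone on the
positive reals. The value of \<open>l x\<close> at \<open>0\<close> is divided into \<open>0 powr \<alpha> = 0\<close>, so it can be replaced by \<open>0\<close>
to obtain a monotone function on the whole line.\<close>

lemma frac_kernel_measurable:
  assumes x: "x \<in> X"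
  shows "frac_kernel d l \<alpha> x \<in> borel_measurable N"
proof -
  define l' where "l' u = (if 0 < u then l x u else 0)" for u
  have "mono l'"
    using l_mono[OF x] l_pos[OF x] by (auto simp: mono_def l'_def less_imp_le)
  then have [measurable]: "l' \<in> borel_measurable borel" by (rule borel_measurable_mono)
  have [measurable]: "d x \<in> borel_measurable N" using x by simp
  have "(\<lambda>y. d x y powr \<alpha> / l' (d x y)) \<in> borel_measurable N" by measurable
  moreover have "frac_kernel d l \<alpha> x y = d x y powr \<alpha> / l' (d x y)" if "y \<in> space N" for y
    using that nonneg[OF x, of y] by (auto simp: frac_kernel_def l'_def space_N)
  ultimately show ?thesis by (simp cong: measurable_cong)
qed

lemma frac_kernel_nonneg:
  assumes "x \<in> X" "y \<in> X"
  shows "0 \<le> frac_kernel d l \<alpha> x y"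
  using nonneg[OF assms] l_pos[OF assms(1), of "d x y"]
  by (cases "d x y = 0") (auto simp: frac_kernel_def)

text \<open>Hoelder's inequality on a ball, up to the factor \<open>2\<close>, with the mass of the ball replaced by its
bound \<open>l x r\<close>.\<close>

lemma ball_integral_le:
  assumes x: "x \<in> X" "0 < r" and p: "1 < p"
    and [measurable]: "f \<in> borel_measurable N" and f0: "\<And>y. 0 \<le> f y"
    and norm: "(\<integral>\<^sup>+y. ennreal (f y powr p) \<partial>N) \<le> 1"
  shows "(\<integral>\<^sup>+y\<in>qball X d x r. ennreal (f y) \<partial>N) \<le> ennreal (2 * l x r powr (1 - 1 / p))"
proof -
  define s where "s = l x r powr (- 1 / p)"
  have a: "0 < l x r" using l_pos x by simp
  have s: "0 < s" using a by (simp add: s_def)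
  have [measurable]: "qball X d x r \<in> sets N" using x by simp
  have "(\<integral>\<^sup>+y\<in>qball X d x r. ennreal (f y) \<partial>N)
      \<le> (\<integral>\<^sup>+y. ennreal s * indicator (qball X d x r) y + ennreal (s powr (1 - p)) * ennreal (f y powr p) \<partial>N)"
  proof (rule nn_integral_mono)
    fix y
    have "ennreal (f y) \<le> ennreal s + ennreal (s powr (1 - p)) * ennreal (f y powr p)"
      using powr_young[OF s f0[of y] p] s
      by (simp add: ennreal_mult[symmetric] ennreal_plus[symmetric] ennreal_leI del: ennreal_plus)
    then show "ennreal (f y) * indicator (qball X d x r) y
        \<le> ennreal s * indicator (qball X d x r) y + ennreal (s powr (1 - p)) * ennreal (f y powr p)"
      by (simp split: split_indicator)
  qed
  also have "\<dots> = ennreal s * emeasure N (qball X d x r)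
      + ennreal (s powr (1 - p)) * (\<integral>\<^sup>+y. ennreal (f y powr p) \<partial>N)"
    by (subst nn_integral_add) (auto simp: nn_integral_cmult nn_integral_cmult_indicator)
  also have "\<dots> \<le> ennreal s * ennreal (l x r) + ennreal (s powr (1 - p)) * 1"
    by (intro add_mono mult_left_mono ball_le x norm) auto
  also have "\<dots> = ennreal (s * l x r + s powr (1 - p))"
    using s a by (simp add: ennreal_mult[symmetric] ennreal_plus[symmetric] del: ennreal_plus)
  also have "s * l x r = l x r powr (1 - 1 / p)"
    using a powr_add[of "l x r" "- 1 / p" 1] by (simp add: s_def)
  also have "s powr (1 - p) = l x r powr (1 - 1 / p)"
  proof -
    have "- 1 / p * (1 - p) = 1 - 1 / p" using p by (simp add: field_simps)
    then show ?thesis by (simp only: s_def powr_powr)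
  qed
  finally show ?thesis by simp
qed

text \<open>On the shell \<open>t \<le> d x y < 2 * t\<close> the kernel is at most \<open>(2 * t) powr \<alpha> / l x t\<close>. The first series collects
the shells inside the ball of radius \<open>r\<close>, the second those outside; the diagonal carries a kernel equal to \<open>0\<close>.\<close>

lemma potential_le_shells:
  assumes x: "x \<in> X" and r: "0 < r" and \<alpha>: "0 < \<alpha>"
    and [measurable]: "f \<in> borel_measurable N" and f0: "\<And>y. 0 \<le> f y"
  defines "T \<equiv> \<lambda>t. ennreal ((2 * t) powr \<alpha> / l x t) * (\<integral>\<^sup>+y\<in>qball X d x (2 * t). ennreal (f y) \<partial>N)"
  shows "(\<integral>\<^sup>+y. ennreal (frac_kernel d l \<alpha> x y * f y) \<partial>N)
    \<le> (\<Sum>n. T (r / 2 ^ Suc n)) + (\<Sum>n. T (r * 2 ^ n))"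
proof -
  define \<tau> where "\<tau> t y = ennreal ((2 * t) powr \<alpha> / l x t) * (ennreal (f y) * indicator (qball X d x (2 * t)) y)"
    for t y
  have [measurable]: "qball X d x s \<in> sets N" for s using x by simp
  have [measurable]: "\<tau> t \<in> borel_measurable N" for t unfolding \<tau>_def by measurable
  have T: "(\<integral>\<^sup>+y. \<tau> t y \<partial>N) = T t" for t
    unfolding \<tau>_def T_def by (rule nn_integral_cmult) simp
  have [measurable]: "(\<lambda>y. \<Sum>n. \<tau> (a n) y) \<in> borel_measurable N" for a :: "nat \<Rightarrow> real"
    by (rule borel_measurable_suminf_order) simp
  have sums: "(\<integral>\<^sup>+y. (\<Sum>n. \<tau> (a n) y) \<partial>N) = (\<Sum>n. \<integral>\<^sup>+y. \<tau> (a n) y \<partial>N)" for a :: "nat \<Rightarrow> real"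
    by (rule nn_integral_suminf) simp
  have shell: "ennreal (frac_kernel d l \<alpha> x y * f y) \<le> \<tau> t y"
    if y: "y \<in> X" and t: "0 < t" "t \<le> d x y" "d x y < 2 * t" for y t
  proof -
    have "frac_kernel d l \<alpha> x y \<le> (2 * t) powr \<alpha> / l x t"
      unfolding frac_kernel_def
      using t l_pos[OF x t(1)] l_mono[OF x t(1,2)] \<alpha> by (intro frac_le powr_mono2) auto
    then have "ennreal (frac_kernel d l \<alpha> x y * f y) \<le> ennreal ((2 * t) powr \<alpha> / l x t * f y)"
      using f0 by (intro ennreal_leI mult_right_mono)
    also have "\<dots> = ennreal ((2 * t) powr \<alpha> / l x t) * ennreal (f y)"
      using f0 by (rule ennreal_mult'')
    also have "\<dots> = \<tau> t y"
      using y t commute[OF x y] by (simp add: \<tau>_def qball_def)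
    finally show ?thesis .
  qed
  have "(\<integral>\<^sup>+y. ennreal (frac_kernel d l \<alpha> x y * f y) \<partial>N)
      \<le> (\<integral>\<^sup>+y. (\<Sum>n. \<tau> (r / 2 ^ Suc n) y) + (\<Sum>n. \<tau> (r * 2 ^ n) y) \<partial>N)"
  proof (rule nn_integral_mono)
    fix y assume "y \<in> space N"
    then have y: "y \<in> X" by (simp add: space_N)
    show "ennreal (frac_kernel d l \<alpha> x y * f y) \<le> (\<Sum>n. \<tau> (r / 2 ^ Suc n) y) + (\<Sum>n. \<tau> (r * 2 ^ n) y)"
    proof (cases "d x y = 0")
      case True
      then show ?thesis by (simp add: frac_kernel_def)
    next
      case False
      then have "0 < d x y" using nonneg[OF x y] by simp
      from dyadic_shell[OF this r] show ?thesis
      proof (elim disjE exE conjE)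
        fix n assume n: "r / 2 ^ Suc n \<le> d x y" "d x y < 2 * (r / 2 ^ Suc n)"
        have "ennreal (frac_kernel d l \<alpha> x y * f y) \<le> \<tau> (r / 2 ^ Suc n) y"
          using r by (intro shell[OF y _ n]) simp
        also have "\<dots> \<le> (\<Sum>n. \<tau> (r / 2 ^ Suc n) y)" by (rule ennreal_term_le_suminf)
        finally show ?thesis by (rule add_increasing2[rotated]) simp
      next
        fix n assume n: "r * 2 ^ n \<le> d x y" "d x y < 2 * (r * 2 ^ n)"
        have "ennreal (frac_kernel d l \<alpha> x y * f y) \<le> \<tau> (r * 2 ^ n) y"
          using r by (intro shell[OF y _ n]) simp
        also have "\<dots> \<le> (\<Sum>n. \<tau> (r * 2 ^ n) y)" by (rule ennreal_term_le_suminf)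
        finally show ?thesis by (rule add_increasing[rotated]) simp
      qed
    qed
  qed
  also have "\<dots> = (\<Sum>n. \<integral>\<^sup>+y. \<tau> (r / 2 ^ Suc n) y \<partial>N) + (\<Sum>n. \<integral>\<^sup>+y. \<tau> (r * 2 ^ n) y \<partial>N)"
    unfolding sums[symmetric] by (rule nn_integral_add) auto
  finally show ?thesis by (simp only: T)
qed

lemma lower_type_const_pos:
  assumes "x \<in> X" "0 < t" "0 < s"
    and "l x (s * t) \<le> c1 * s powr \<alpha>0 * l x t"
  shows "0 < c1"
proof -
  have "0 < c1 * s powr \<alpha>0 * l x t"
    using assms l_pos[of x "s * t"] by (intro less_le_trans[OF _ assms(4)]) simp
  then show ?thesis
    using assms l_pos[of x t] by (simp add: zero_less_mult_iff)
qed

lemma lower_type_growth: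
  assumes lt: "\<And>s t. 0 < s \<Longrightarrow> s \<le> 1 \<Longrightarrow> 0 < t \<Longrightarrow> l x (s * t) \<le> c1 * s powr \<alpha>0 * l x t"
    and r: "0 < r"
  shows "(2 powr \<alpha>0) ^ n * l x r \<le> c1 * l x (r * 2 ^ n)"
proof -
  have "l x r = l x (1 / 2 ^ n * (r * 2 ^ n))" by simp
  also have "\<dots> \<le> c1 * (1 / 2 ^ n) powr \<alpha>0 * l x (r * 2 ^ n)"
    using r by (intro lt) (auto simp: field_simps)
  also have "(1 / 2 ^ n) powr \<alpha>0 = 1 / (2 powr \<alpha>0) ^ n"
    by (simp add: powr_divide powr_powr powr_realpow[symmetric] mult.commute)
  finally show ?thesis by (simp add: field_simps)
qed

text \<open>By the lower type, \<open>l x\<close> tends to \<open>0\<close> at \<open>0\<close> and to \<open>\<infinity>\<close> at \<open>\<infinity>\<close>, so doubling a small radius repeatedly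
makes \<open>l x\<close> pass any level \<open>a\<close>. Since \<open>l x\<close> may jump, the level is only bracketed; as \<open>l\<close> is doubling,
the two ends of the bracket are comparable.\<close>

lemma exists_radius:
  assumes x: "x \<in> X" and \<alpha>0: "0 < \<alpha>0" and a: "0 < a"
    and lt: "\<And>s t. 0 < s \<Longrightarrow> s \<le> 1 \<Longrightarrow> 0 < t \<Longrightarrow> l x (s * t) \<le> c1 * s powr \<alpha>0 * l x t"
  shows "\<exists>r>0. l x r \<le> a \<and> a < l x (2 * r)"
proof -
  have c1: "0 < c1" using lower_type_const_pos[OF x, of 1 1] lt[of 1 1] by simp
  have l1: "0 < l x 1" using l_pos[OF x] by simp
  \<comment> \<open>solves \<open>c1 * \<sigma> powr \<alpha>0 * l x 1 = a\<close>, unless that exceeds \<open>1\<close>\<close>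
  define \<sigma> where "\<sigma> = min 1 ((a / (c1 * l x 1)) powr (1 / \<alpha>0))"
  have \<sigma>: "0 < \<sigma>" "\<sigma> \<le> 1" using a c1 l1 by (auto simp: \<sigma>_def)
  have "l x \<sigma> \<le> c1 * \<sigma> powr \<alpha>0 * l x 1" using lt[OF \<sigma>, of 1] by simp
  also have "\<dots> \<le> c1 * ((a / (c1 * l x 1)) powr (1 / \<alpha>0)) powr \<alpha>0 * l x 1"
    using c1 l1 \<alpha>0 \<sigma> by (intro mult_right_mono mult_left_mono powr_mono2) (auto simp: \<sigma>_def)
  also have "\<dots> = a" using c1 l1 \<alpha>0 a by (simp add: powr_powr)
  finally have small: "l x \<sigma> \<le> a" .
  have l\<sigma>: "0 < l x \<sigma>" using l_pos[OF x \<sigma>(1)] .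
  obtain n where n: "c1 * a / l x \<sigma> < (2 powr \<alpha>0) ^ n"
    using real_arch_pow[of "2 powr \<alpha>0"] \<alpha>0 by auto
  then have "c1 * a < (2 powr \<alpha>0) ^ n * l x \<sigma>" using l\<sigma> by (simp add: field_simps)
  also have "\<dots> \<le> c1 * l x (\<sigma> * 2 ^ n)" by (rule lower_type_growth[OF lt \<sigma>(1)])
  finally have "a < l x (\<sigma> * 2 ^ n)" using c1 by simp
  then have "\<exists>n. a < l x (\<sigma> * 2 ^ n)" ..
  then have "\<exists>n. a < l x (\<sigma> * 2 ^ n) \<and> (\<forall>m<n. \<not> a < l x (\<sigma> * 2 ^ m))"
    by (rule exists_least_iff[THEN iffD1])
  then obtain k where k: "a < l x (\<sigma> * 2 ^ k)" "\<And>m. m < k \<Longrightarrow> l x (\<sigma> * 2 ^ m) \<le> a" by (auto simp: not_less)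
  then obtain m where m: "k = Suc m" using small by (cases k) auto
  show ?thesis
    using k(1) k(2)[of m] \<sigma> m by (intro exI[of _ "\<sigma> * 2 ^ m"]) (auto simp: mult_ac)
qed

text \<open>Inner shells: the integral \<open>I\<close> of the function over the ball of radius \<open>2 * t\<close> is controlled by the maximal
function, whose denominator \<open>l x (\<kappa> * (2 * t))\<close> cancels that of the kernel up to doubling.\<close>

lemma near_shell_le:
  assumes x: "x \<in> X" and t: "0 < t" and A: "0 \<le> A" and C: "l x (\<kappa> * (2 * t)) \<le> C * l x t"
    and I: "I \<le> ennreal (l x (\<kappa> * (2 * t)) * A)"
  shows "ennreal ((2 * t) powr \<alpha> / l x t) * I \<le> ennreal (C * A * (2 * t) powr \<alpha>)"
proof -
  have pos: "0 < l x t" using l_pos x t by simp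
  have "ennreal ((2 * t) powr \<alpha> / l x t) * I
      \<le> ennreal ((2 * t) powr \<alpha> / l x t) * ennreal (l x (\<kappa> * (2 * t)) * A)"
    by (intro mult_left_mono I) simp
  also have "\<dots> = ennreal ((2 * t) powr \<alpha> / l x t * (l x (\<kappa> * (2 * t)) * A))"
    using pos by (intro ennreal_mult'[symmetric]) simp
  also have "\<dots> \<le> ennreal ((2 * t) powr \<alpha> / l x t * (C * l x t * A))"
    using pos A C by (intro ennreal_leI mult_left_mono mult_right_mono) auto
  also have "(2 * t) powr \<alpha> / l x t * (C * l x t * A) = C * A * (2 * t) powr \<alpha>"
    using pos by (simp add: field_simps)
  finally show ?thesis .
qed

text \<open>Outer shells: \<open>I\<close> is controlled by the \<open>L\<^sup>p\<close> norm, and the comparison of \<open>r powr \<alpha>\<close> with \<open>l\<close> enters at the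
radius \<open>2 * t\<close>, where it trades the factor \<open>(2 * t) powr \<alpha>\<close> for a change of exponent from \<open>p\<close> to \<open>q\<close>.\<close>

lemma far_shell_le:
  assumes x: "x \<in> X" and t: "0 < t" and C: "l x (2 * t) \<le> C * l x t"
    and I: "I \<le> ennreal (2 * l x (2 * t) powr (1 - 1 / p))"
    and comp: "(2 * t) powr \<alpha> \<le> l x (2 * t) powr (1 / p - 1 / q)" and q: "0 < q"
  shows "ennreal ((2 * t) powr \<alpha> / l x t) * I \<le> ennreal (2 * C * l x t powr (- 1 / q))"
proof -
  define b where "b = l x (2 * t)"
  have pos: "0 < l x t" "0 < b" using l_pos x t by (auto simp: b_def)
  have mono: "l x t \<le> b" unfolding b_def using x t by (intro l_mono) auto
  have C0: "0 < C"
  proof -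
    have "0 < C * l x t" using C pos unfolding b_def by linarith
    then show ?thesis using pos by (simp add: zero_less_mult_iff)
  qed
  have "ennreal ((2 * t) powr \<alpha> / l x t) * I
      \<le> ennreal ((2 * t) powr \<alpha> / l x t) * ennreal (2 * b powr (1 - 1 / p))"
    unfolding b_def by (intro mult_left_mono I) simp
  also have "\<dots> = ennreal ((2 * t) powr \<alpha> / l x t * (2 * b powr (1 - 1 / p)))"
    using pos by (intro ennreal_mult'[symmetric]) simp
  also have "\<dots> \<le> ennreal (2 * C * l x t powr (- 1 / q))"
  proof (rule ennreal_leI)
    have "(2 * t) powr \<alpha> / l x t * (2 * b powr (1 - 1 / p))
        \<le> b powr (1 / p - 1 / q) / l x t * (2 * b powr (1 - 1 / p))"
      using comp pos unfolding b_def by (intro mult_right_mono divide_right_mono) auto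
    also have "\<dots> = 2 * (b powr (1 / p - 1 / q) * b powr (1 - 1 / p)) / l x t" by simp
    also have "b powr (1 / p - 1 / q) * b powr (1 - 1 / p) = b * b powr (- 1 / q)"
      using pos powr_add[of b 1 "- 1 / q"] by (simp add: powr_add[symmetric])
    also have "2 * (b * b powr (- 1 / q)) / l x t \<le> 2 * ((C * l x t) * l x t powr (- 1 / q)) / l x t"
      using pos C C0 q mono unfolding b_def[symmetric]
      by (intro divide_right_mono mult_left_mono mult_mono powr_mono2') auto
    also have "\<dots> = 2 * C * l x t powr (- 1 / q)" using pos by simp
    finally show "(2 * t) powr \<alpha> / l x t * (2 * b powr (1 - 1 / p)) \<le> 2 * C * l x t powr (- 1 / q)" .
  qed
  finally show ?thesis .
qed

text \<open>Hedberg's inequality: the potential of a function of unit \<open>L\<^sup>p\<close> norm is at most a multiple of the power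
\<open>p / q x\<close> of its maximal function, provided the latter is replaced by its maximum \<open>A\<close> with \<open>1\<close>. The cut is
made at a radius with \<open>l x r\<close> comparable to \<open>A powr (- p)\<close>, where the bounds for inner and outer shells
balance: both are multiples of \<open>u = l x r powr (- 1 / q x)\<close>. The inner shells decay by the factor
\<open>w = 2 powr (- \<alpha>)\<close> and the outer ones, by the lower type, by \<open>v = 2 powr (- \<alpha>0 / Q)\<close>; the constant is uniform
in \<open>x\<close> because \<open>Q\<close> bounds the exponents \<open>q x\<close>.\<close>

lemma hedberg:
  assumes \<alpha>: "0 < \<alpha>" and p: "1 < p" and \<alpha>0: "0 < \<alpha>0" and \<kappa>: "1 \<le> \<kappa>"
    and lt: "\<And>x s t. x \<in> X \<Longrightarrow> 0 < s \<Longrightarrow> s \<le> 1 \<Longrightarrow> 0 < t \<Longrightarrow> l x (s * t) \<le> c1 * s powr \<alpha>0 * l x t"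
    and q: "\<And>x. x \<in> X \<Longrightarrow> 1 < q x \<and> q x \<le> Q"
    and comp: "\<And>x r. x \<in> X \<Longrightarrow> 0 < r \<Longrightarrow> r powr \<alpha> \<le> l x r powr (1 / p - 1 / q x)"
  obtains C where "1 \<le> C"
    "\<And>f x A. f \<in> borel_measurable N \<Longrightarrow> (\<And>y. 0 \<le> f y) \<Longrightarrow> (\<integral>\<^sup>+y. ennreal (f y powr p) \<partial>N) \<le> 1 \<Longrightarrow>
       x \<in> X \<Longrightarrow> 1 \<le> A \<Longrightarrow>
       (\<And>r. 0 < r \<Longrightarrow> (\<integral>\<^sup>+y\<in>qball X d x r. ennreal (f y) \<partial>N) \<le> ennreal (l x (\<kappa> * r) * A)) \<Longrightarrow>
       (\<integral>\<^sup>+y. ennreal (frac_kernel d l \<alpha> x y * f y) \<partial>N) \<le> ennreal (C * A powr (p / q x))"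
proof -
  obtain C1 where C1: "1 \<le> C1" and dil: "\<And>x r. x \<in> X \<Longrightarrow> 0 < r \<Longrightarrow> l x (2 * \<kappa> * r) \<le> C1 * l x r"
    using l_dilation[of "2 * \<kappa>"] \<kappa> by auto
  have dbl: "l x (2 * r) \<le> C1 * l x r" if "x \<in> X" "0 < r" for x r
    using dil[OF that] l_mono[OF that(1), of "2 * r" "2 * \<kappa> * r"] that \<kappa> by simp
  define w :: real where "w = 2 powr (- \<alpha>)"
  define v :: real where "v = 2 powr (- (\<alpha>0 / Q))"
  define c where "c = max 1 c1"
  \<comment> \<open>\<open>v < 1\<close> depends on \<open>Q > 0\<close>, which is known only once a point of \<open>X\<close> is given; the absolute value keeps the bounds nonnegative formally\<close>
  define C where "C = max 1 ((C1 / (1 - w) + 2 * C1 * c / \<bar>1 - v\<bar>) * C1)"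
  have w: "0 < w" "w < 1" using \<alpha> by (auto simp: w_def powr_less_one)
  have main: "(\<integral>\<^sup>+y. ennreal (frac_kernel d l \<alpha> x y * f y) \<partial>N) \<le> ennreal (C * A powr (p / q x))"
    if [measurable]: "f \<in> borel_measurable N" and f0: "\<And>y. 0 \<le> f y"
      and norm: "(\<integral>\<^sup>+y. ennreal (f y powr p) \<partial>N) \<le> 1" and x: "x \<in> X" and A: "1 \<le> A"
      and max: "\<And>r. 0 < r \<Longrightarrow> (\<integral>\<^sup>+y\<in>qball X d x r. ennreal (f y) \<partial>N) \<le> ennreal (l x (\<kappa> * r) * A)"
    for f x A
  proof -
    have qx: "1 < q x" "q x \<le> Q" using q[OF x] by auto
    have v: "0 < v" "v < 1" using \<alpha>0 qx by (auto simp: v_def powr_less_one)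
    have c1: "0 < c1" using lower_type_const_pos[OF x, of 1 1] lt[OF x, of 1 1] by simp
    obtain r where r: "0 < r" and small: "l x r \<le> A powr (- p)" and large: "A powr (- p) < l x (2 * r)"
      using exists_radius[OF x \<alpha>0 _ lt[OF x], of "A powr (- p)"] A by auto
    define u where "u = l x r powr (- 1 / q x)"
    have lr: "0 < l x r" using l_pos[OF x r] .
    define T where "T t = ennreal ((2 * t) powr \<alpha> / l x t) * (\<integral>\<^sup>+y\<in>qball X d x (2 * t). ennreal (f y) \<partial>N)" for t
    have "(\<Sum>n. T (r / 2 ^ Suc n)) \<le> (\<Sum>n. ennreal (C1 * u * w ^ n))"
    proof (intro suminf_le summableI)
      fix n
      have t: "0 < r / 2 ^ Suc n" using r by simp
      have "T (r / 2 ^ Suc n) \<le> ennreal (C1 * A * (2 * (r / 2 ^ Suc n)) powr \<alpha>)"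
        unfolding T_def
        by (rule near_shell_le[OF x t, where \<kappa> = \<kappa>]) (use A t dil[OF x t] max[of "2 * (r / 2 ^ Suc n)"] in \<open>auto simp: mult_ac\<close>)
      also have "\<dots> \<le> ennreal (C1 * u * w ^ n)"
      proof (rule ennreal_leI)
        have "(2 * (r / 2 ^ Suc n)) powr \<alpha> = r powr \<alpha> * w ^ n"
          using r by (simp add: w_def powr_divide powr_powr powr_realpow[symmetric] powr_minus field_simps)
        moreover have "A * r powr \<alpha> \<le> u"
        proof -
          have "A * r powr \<alpha> \<le> A * l x r powr (1 / p - 1 / q x)"
            using A comp[OF x r] by (intro mult_left_mono) auto
          also have "\<dots> = A * l x r powr (1 / p) * u"
            using powr_add[of "l x r" "1 / p" "- 1 / q x"] by (simp add: u_def)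
          also have "\<dots> \<le> A * (A powr (- p)) powr (1 / p) * u"
            using small lr p A by (intro mult_right_mono mult_left_mono powr_mono2) (auto simp: u_def)
          also have "(A powr (- p)) powr (1 / p) = 1 / A"
            unfolding powr_powr using A p by (simp add: powr_neg_one)
          also have "A * (1 / A) * u = u" using A by simp
          finally show ?thesis .
        qed
        ultimately show "C1 * A * (2 * (r / 2 ^ Suc n)) powr \<alpha> \<le> C1 * u * w ^ n"
          using C1 w mult_right_mono[of "A * r powr \<alpha>" u "C1 * w ^ n"] by (simp add: mult_ac)
      qed
      finally show "T (r / 2 ^ Suc n) \<le> ennreal (C1 * u * w ^ n)" .
    qed
    also have "\<dots> = ennreal (C1 * u * (1 / (1 - w)))"
      using w C1 by (intro suminf_ennreal_eq sums_mult geometric_sums) (auto simp: u_def)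
    finally have near: "(\<Sum>n. T (r / 2 ^ Suc n)) \<le> ennreal (C1 * u * (1 / (1 - w)))" .
    have "(\<Sum>n. T (r * 2 ^ n)) \<le> (\<Sum>n. ennreal (2 * C1 * c * u * v ^ n))"
    proof (intro suminf_le summableI)
      fix n
      have t: "0 < r * 2 ^ n" using r by simp
      have lt_pos: "0 < l x (r * 2 ^ n)" using l_pos[OF x t] .
      have "T (r * 2 ^ n) \<le> ennreal (2 * C1 * l x (r * 2 ^ n) powr (- 1 / q x))"
        unfolding T_def
      proof (rule far_shell_le[OF x t dbl[OF x t]])
        show "(\<integral>\<^sup>+y\<in>qball X d x (2 * (r * 2 ^ n)). ennreal (f y) \<partial>N)
            \<le> ennreal (2 * l x (2 * (r * 2 ^ n)) powr (1 - 1 / p))"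
          using t by (intro ball_integral_le x p f0 norm) auto
        show "(2 * (r * 2 ^ n)) powr \<alpha> \<le> l x (2 * (r * 2 ^ n)) powr (1 / p - 1 / q x)"
          using t by (intro comp x) auto
      qed (use qx in simp)
      also have "\<dots> \<le> ennreal (2 * C1 * c * u * v ^ n)"
      proof (rule ennreal_leI)
        have "(2 powr \<alpha>0) ^ n * l x r \<le> c1 * l x (r * 2 ^ n)"
          by (rule lower_type_growth[OF lt[OF x] r])
        then have "(2 powr \<alpha>0) ^ n * l x r / c1 \<le> l x (r * 2 ^ n)"
          using c1 by (simp add: field_simps)
        then have "l x (r * 2 ^ n) powr (- 1 / q x) \<le> ((2 powr \<alpha>0) ^ n * l x r / c1) powr (- 1 / q x)"
          using c1 lr qx by (intro powr_mono2') auto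
        also have "\<dots> = c1 powr (1 / q x) * u * ((2 powr \<alpha>0) ^ n) powr (- 1 / q x)"
          using c1 lr by (simp add: u_def powr_divide powr_mult powr_minus field_simps)
        also have "\<dots> \<le> c * u * v ^ n"
        proof (intro mult_mono)
          have "c1 powr (1 / q x) \<le> c powr (1 / q x)"
            using c1 qx by (intro powr_mono2) (auto simp: c_def)
          also have "\<dots> \<le> c powr 1" using qx by (intro powr_mono) (auto simp: c_def)
          finally show "c1 powr (1 / q x) \<le> c" by (simp add: c_def)
          have "((2 powr \<alpha>0) ^ n) powr (- 1 / q x) = (2::real) powr (- (real n * \<alpha>0 / q x))"
            by (simp add: powr_powr powr_realpow[symmetric] mult.commute)
          also have "\<dots> \<le> 2 powr (- (real n * \<alpha>0 / Q))"
            using qx \<alpha>0 by (intro powr_mono) (auto intro: divide_left_mono)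
          also have "\<dots> = v ^ n"
            by (simp add: v_def powr_powr powr_realpow[symmetric] mult.commute)
          finally show "((2 powr \<alpha>0) ^ n) powr (- 1 / q x) \<le> v ^ n" .
        qed (auto simp: u_def c_def)
        finally show "2 * C1 * l x (r * 2 ^ n) powr (- 1 / q x) \<le> 2 * C1 * c * u * v ^ n"
          using C1 by (simp add: mult.assoc)
      qed
      finally show "T (r * 2 ^ n) \<le> ennreal (2 * C1 * c * u * v ^ n)" .
    qed
    also have "\<dots> = ennreal (2 * C1 * c * u * (1 / (1 - v)))"
      using v C1 by (intro suminf_ennreal_eq sums_mult geometric_sums) (auto simp: u_def c_def)
    finally have far: "(\<Sum>n. T (r * 2 ^ n)) \<le> ennreal (2 * C1 * c * u * (1 / (1 - v)))" .
    have "(\<integral>\<^sup>+y. ennreal (frac_kernel d l \<alpha> x y * f y) \<partial>N) \<le> (\<Sum>n. T (r / 2 ^ Suc n)) + (\<Sum>n. T (r * 2 ^ n))"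
      unfolding T_def by (rule potential_le_shells[OF x r \<alpha>]) (use f0 in auto)
    also have "\<dots> \<le> ennreal (C1 * u * (1 / (1 - w))) + ennreal (2 * C1 * c * u * (1 / (1 - v)))"
      by (intro add_mono near far)
    also have "\<dots> = ennreal (C1 * u * (1 / (1 - w)) + 2 * C1 * c * u * (1 / (1 - v)))"
      using w v C1 by (intro ennreal_plus[symmetric]) (auto simp: u_def c_def)
    also have "\<dots> \<le> ennreal (C * A powr (p / q x))"
    proof (rule ennreal_leI)
      have "A powr (- p) / C1 \<le> l x r" using large dbl[OF x r] C1 by (simp add: field_simps)
      then have "u \<le> (A powr (- p) / C1) powr (- 1 / q x)"
        unfolding u_def using A C1 qx by (intro powr_mono2') auto
      also have "\<dots> = C1 powr (1 / q x) * A powr (p / q x)"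
        using A C1 by (simp add: powr_divide powr_mult powr_powr powr_minus field_simps)
      also have "\<dots> \<le> C1 powr 1 * A powr (p / q x)"
        using C1 qx by (intro mult_right_mono powr_mono) auto
      finally have u: "u \<le> C1 * A powr (p / q x)" using C1 by simp
      have "C1 * u * (1 / (1 - w)) + 2 * C1 * c * u * (1 / (1 - v))
          = (C1 / (1 - w) + 2 * C1 * c / \<bar>1 - v\<bar>) * u"
        using v by (simp add: distrib_right)
      also have "\<dots> \<le> (C1 / (1 - w) + 2 * C1 * c / \<bar>1 - v\<bar>) * (C1 * A powr (p / q x))"
        using u w v C1 by (intro mult_left_mono) (auto simp: c_def)
      also have "\<dots> \<le> C * A powr (p / q x)"
        unfolding C_def mult.assoc[symmetric] by (intro mult_right_mono) auto
      finally show "C1 * u * (1 / (1 - w)) + 2 * C1 * c * u * (1 / (1 - v)) \<le> C * A powr (p / q x)" .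
    qed
    finally show ?thesis .
  qed
  have "1 \<le> C" by (simp add: C_def)
  then show thesis by (rule that) (rule main)
qed

end

section \<open>Boundedness of the fractional integral\<close>

context upper_doubling_space
begin

text \<open>The maximal theorem and Hedberg's inequality combined, with the norm of \<open>f\<close> scaled out as the factor
\<open>m\<close>. One function \<open>g\<close> controls both convergence and size: where it is finite, the integral
defining the potential converges absolutely, and \<open>g\<close> dominates the power \<open>q x\<close> of a bound \<open>B\<close> for the
potential of \<open>f / m\<close>.\<close>

lemma frac_integral_majorant:
  assumes \<alpha>: "0 < \<alpha>" and p: "1 < p" and lt: "lower_type_greater X l \<alpha>"
    and q: "\<And>x. x \<in> X \<Longrightarrow> 1 < q x \<and> q x \<le> Q"
    and comp: "\<And>x r. x \<in> X \<Longrightarrow> 0 < r \<Longrightarrow> r powr \<alpha> \<le> l x r powr (1 / p - 1 / q x)"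
  obtains C where "1 \<le> C"
    "\<And>f m. f \<in> borel_measurable N \<Longrightarrow> 0 < m \<Longrightarrow> (\<integral>\<^sup>+y. ennreal (\<bar>f y\<bar> powr p) \<partial>N) \<le> ennreal (m powr p) \<Longrightarrow>
       \<exists>g\<in>borel_measurable N. (\<integral>\<^sup>+x. g x \<partial>N) \<le> ennreal C \<and>
         (\<forall>x\<in>X. g x \<noteq> \<infinity> \<longrightarrow> integrable N (\<lambda>y. frac_kernel d l \<alpha> x y * f y) \<and>
            (\<exists>B\<ge>0. \<bar>frac_integral N d l \<alpha> f x\<bar> \<le> m * B \<and> ennreal (B powr q x) \<le> g x))"
proof -
  obtain \<alpha>0 c1 where "\<alpha> < \<alpha>0" and lt': "\<And>x s t. x \<in> X \<Longrightarrow> 0 < s \<Longrightarrow> s \<le> 1 \<Longrightarrow> 0 < t \<Longrightarrow>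
      l x (s * t) \<le> c1 * s powr \<alpha>0 * l x t"
    using lt unfolding lower_type_greater_def by blast
  then have \<alpha>0: "0 < \<alpha>0" using \<alpha> by simp
  obtain \<kappa> C2 where \<kappa>: "1 \<le> \<kappa>" and C2: "0 \<le> C2" and strong:
    "\<And>f. f \<in> borel_measurable N \<Longrightarrow> (\<And>y. 0 \<le> f y) \<Longrightarrow> (\<integral>\<^sup>+y. ennreal (f y powr p) \<partial>N) \<le> 1 \<Longrightarrow>
       \<exists>g\<in>borel_measurable N. (\<integral>\<^sup>+x. g x \<partial>N) \<le> ennreal C2 \<and>
         (\<forall>x\<in>X. g x \<noteq> \<infinity> \<longrightarrow> (\<exists>A\<ge>1. ennreal (A powr p) \<le> g x \<and>
            (\<forall>r>0. (\<integral>\<^sup>+y\<in>qball X d x r. ennreal (f y) \<partial>N) \<le> ennreal (l x (\<kappa> * r) * A))))"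
    by (rule maximal_strong_type[OF p]) blast
  obtain C1 where C1: "1 \<le> C1" and hed:
    "\<And>f x A. f \<in> borel_measurable N \<Longrightarrow> (\<And>y. 0 \<le> f y) \<Longrightarrow> (\<integral>\<^sup>+y. ennreal (f y powr p) \<partial>N) \<le> 1 \<Longrightarrow>
       x \<in> X \<Longrightarrow> 1 \<le> A \<Longrightarrow>
       (\<And>r. 0 < r \<Longrightarrow> (\<integral>\<^sup>+y\<in>qball X d x r. ennreal (f y) \<partial>N) \<le> ennreal (l x (\<kappa> * r) * A)) \<Longrightarrow>
       (\<integral>\<^sup>+y. ennreal (frac_kernel d l \<alpha> x y * f y) \<partial>N) \<le> ennreal (C1 * A powr (p / q x))"
    by (rule hedberg[OF \<alpha> p \<alpha>0 \<kappa> lt' q comp]) blast+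
  define C where "C = max 1 (C1 powr Q * C2)"
  have main: "\<exists>g\<in>borel_measurable N. (\<integral>\<^sup>+x. g x \<partial>N) \<le> ennreal C \<and>
         (\<forall>x\<in>X. g x \<noteq> \<infinity> \<longrightarrow> integrable N (\<lambda>y. frac_kernel d l \<alpha> x y * f y) \<and>
            (\<exists>B\<ge>0. \<bar>frac_integral N d l \<alpha> f x\<bar> \<le> m * B \<and> ennreal (B powr q x) \<le> g x))"
    if f[measurable]: "f \<in> borel_measurable N" and m: "0 < m"
      and norm: "(\<integral>\<^sup>+y. ennreal (\<bar>f y\<bar> powr p) \<partial>N) \<le> ennreal (m powr p)" for f m
  proof -
    define F where "F y = \<bar>f y\<bar> / m" for y
    have F[measurable]: "F \<in> borel_measurable N" unfolding F_def by measurable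
    have F0: "0 \<le> F y" for y using m by (simp add: F_def)
    have "(\<integral>\<^sup>+y. ennreal (F y powr p) \<partial>N) = (\<integral>\<^sup>+y. ennreal (1 / m powr p) * ennreal (\<bar>f y\<bar> powr p) \<partial>N)"
      using m by (intro nn_integral_cong) (simp add: F_def powr_divide ennreal_mult'[symmetric])
    also have "\<dots> = ennreal (1 / m powr p) * (\<integral>\<^sup>+y. ennreal (\<bar>f y\<bar> powr p) \<partial>N)"
      by (rule nn_integral_cmult) simp
    also have "\<dots> \<le> ennreal (1 / m powr p) * ennreal (m powr p)"
      by (intro mult_left_mono norm) simp
    also have "\<dots> = 1" using m by (simp add: ennreal_mult'[symmetric])
    finally have normF: "(\<integral>\<^sup>+y. ennreal (F y powr p) \<partial>N) \<le> 1" .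
    from strong[OF F F0 normF] obtain g0 where g0[measurable]: "g0 \<in> borel_measurable N"
      and g0_int: "(\<integral>\<^sup>+x. g0 x \<partial>N) \<le> ennreal C2"
      and g0_max: "\<forall>x\<in>X. g0 x \<noteq> \<infinity> \<longrightarrow> (\<exists>A\<ge>1. ennreal (A powr p) \<le> g0 x \<and>
            (\<forall>r>0. (\<integral>\<^sup>+y\<in>qball X d x r. ennreal (F y) \<partial>N) \<le> ennreal (l x (\<kappa> * r) * A)))"
      by (elim bexE conjE)
    define g where "g x = ennreal (C1 powr Q) * g0 x" for x
    have g: "g \<in> borel_measurable N" unfolding g_def by measurable
    have "(\<integral>\<^sup>+x. g x \<partial>N) = ennreal (C1 powr Q) * (\<integral>\<^sup>+x. g0 x \<partial>N)"
      unfolding g_def by (rule nn_integral_cmult) simp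
    also have "\<dots> \<le> ennreal (C1 powr Q) * ennreal C2" by (intro mult_left_mono g0_int) simp
    also have "\<dots> = ennreal (C1 powr Q * C2)" by (simp add: ennreal_mult'[symmetric])
    also have "\<dots> \<le> ennreal C" by (simp add: C_def ennreal_leI)
    finally have g_int: "(\<integral>\<^sup>+x. g x \<partial>N) \<le> ennreal C" .
    have "integrable N (\<lambda>y. frac_kernel d l \<alpha> x y * f y) \<and>
        (\<exists>B\<ge>0. \<bar>frac_integral N d l \<alpha> f x\<bar> \<le> m * B \<and> ennreal (B powr q x) \<le> g x)"
      if x: "x \<in> X" and fin: "g x \<noteq> \<infinity>" for x
    proof -
      have "g0 x \<noteq> \<infinity>" using fin C1 by (auto simp: g_def ennreal_mult_eq_top_iff)
      then obtain A where A: "1 \<le> A" and Ag: "ennreal (A powr p) \<le> g0 x"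
        and max: "\<And>r. 0 < r \<Longrightarrow> (\<integral>\<^sup>+y\<in>qball X d x r. ennreal (F y) \<partial>N) \<le> ennreal (l x (\<kappa> * r) * A)"
        using g0_max x by blast
      define B where "B = C1 * A powr (p / q x)"
      have qx: "1 < q x" "q x \<le> Q" using q[OF x] by auto
      have B0: "0 \<le> B" using C1 by (simp add: B_def)
      have [measurable]: "frac_kernel d l \<alpha> x \<in> borel_measurable N" using x by (rule frac_kernel_measurable)
      have "(\<integral>\<^sup>+y. ennreal (norm (frac_kernel d l \<alpha> x y * f y)) \<partial>N)
          = (\<integral>\<^sup>+y. ennreal m * ennreal (frac_kernel d l \<alpha> x y * F y) \<partial>N)"
        using m frac_kernel_nonneg[OF x, of _ \<alpha>]
        by (intro nn_integral_cong) (simp add: F_def space_N abs_mult ennreal_mult'[symmetric])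
      also have "\<dots> = ennreal m * (\<integral>\<^sup>+y. ennreal (frac_kernel d l \<alpha> x y * F y) \<partial>N)"
        by (rule nn_integral_cmult) simp
      also have "\<dots> \<le> ennreal m * ennreal B"
        unfolding B_def by (intro mult_left_mono hed[OF F F0 normF x A max]) simp_all
      also have "\<dots> = ennreal (m * B)" using m by (simp add: ennreal_mult')
      finally have le: "(\<integral>\<^sup>+y. ennreal (norm (frac_kernel d l \<alpha> x y * f y)) \<partial>N) \<le> ennreal (m * B)" .
      have int: "integrable N (\<lambda>y. frac_kernel d l \<alpha> x y * f y)"
        using le by (intro integrableI_bounded) (auto simp: le_less_trans)
      have "ennreal (norm (frac_integral N d l \<alpha> f x)) \<le> ennreal (m * B)"
        unfolding frac_integral_def using integral_norm_bound_ennreal[OF int] le by (rule order_trans)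
      then have bound: "\<bar>frac_integral N d l \<alpha> f x\<bar> \<le> m * B" using m B0 by simp
      have "B powr q x = C1 powr q x * A powr p"
        using C1 A qx by (simp add: B_def powr_mult powr_powr)
      also have "\<dots> \<le> C1 powr Q * A powr p"
        using C1 qx by (intro mult_right_mono powr_mono) auto
      finally have "ennreal (B powr q x) \<le> ennreal (C1 powr Q) * ennreal (A powr p)"
        by (simp add: ennreal_mult'[symmetric] ennreal_leI)
      also have "\<dots> \<le> g x" unfolding g_def by (intro mult_left_mono Ag) simp
      finally show ?thesis using int bound B0 by blast
    qed
    with g g_int show ?thesis by (intro bexI[OF _ g] conjI ballI impI) simp_all
  qed
  have "1 \<le> C" by (simp add: C_def)
  then show thesis by (rule that) (rule main)
qed

text \<open>From the majorant to the norm. The modular of a function that is not measurable is a lower integral,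
for which upper bounds by a measurable majorant are still valid. Any \<open>m > 0\<close> not less than the norm
of \<open>f\<close> is admissible in the majorant, which treats \<open>f = 0\<close> together with the other functions: the
norm itself is approached from above.\<close>

theorem frac_integral_boundedI:
  assumes \<alpha>: "0 < \<alpha>" and p: "1 < p" and lt: "lower_type_greater X l \<alpha>"
    and q: "\<And>x. x \<in> X \<Longrightarrow> 1 < q x \<and> q x \<le> Q"
    and comp: "\<And>x r. x \<in> X \<Longrightarrow> 0 < r \<Longrightarrow> r powr \<alpha> \<le> l x r powr (1 / p - 1 / q x)"
  shows "frac_integral_bounded N d l \<alpha> p q"
proof -
  obtain C where C: "1 \<le> C" and maj:
    "\<And>f m. f \<in> borel_measurable N \<Longrightarrow> 0 < m \<Longrightarrow> (\<integral>\<^sup>+y. ennreal (\<bar>f y\<bar> powr p) \<partial>N) \<le> ennreal (m powr p) \<Longrightarrow>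
       \<exists>g\<in>borel_measurable N. (\<integral>\<^sup>+x. g x \<partial>N) \<le> ennreal C \<and>
         (\<forall>x\<in>X. g x \<noteq> \<infinity> \<longrightarrow> integrable N (\<lambda>y. frac_kernel d l \<alpha> x y * f y) \<and>
            (\<exists>B\<ge>0. \<bar>frac_integral N d l \<alpha> f x\<bar> \<le> m * B \<and> ennreal (B powr q x) \<le> g x))"
    by (rule frac_integral_majorant[OF \<alpha> p lt q comp]) blast+
  have modular: "var_modular N q (\<lambda>x. frac_integral N d l \<alpha> f x / t) \<le> ennreal (E * C)"
    if f: "f \<in> borel_measurable N" and m: "0 < m"
      and norm: "(\<integral>\<^sup>+y. ennreal (\<bar>f y\<bar> powr p) \<partial>N) \<le> ennreal (m powr p)"
      and t: "0 < t" and E: "0 < E" "\<And>x. x \<in> X \<Longrightarrow> (m / t) powr q x \<le> E" for f m t E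
  proof -
    obtain g where g[measurable]: "g \<in> borel_measurable N" and g_int: "(\<integral>\<^sup>+x. g x \<partial>N) \<le> ennreal C"
      and g_max: "\<forall>x\<in>X. g x \<noteq> \<infinity> \<longrightarrow> integrable N (\<lambda>y. frac_kernel d l \<alpha> x y * f y) \<and>
            (\<exists>B\<ge>0. \<bar>frac_integral N d l \<alpha> f x\<bar> \<le> m * B \<and> ennreal (B powr q x) \<le> g x)"
      using maj[OF f m norm] by (elim bexE conjE)
    have "var_modular N q (\<lambda>x. frac_integral N d l \<alpha> f x / t) \<le> (\<integral>\<^sup>+x. ennreal E * g x \<partial>N)"
      unfolding var_modular_def
    proof (rule nn_integral_mono)
      fix x assume "x \<in> space N"
      then have x: "x \<in> X" by (simp add: space_N)
      show "ennreal (\<bar>frac_integral N d l \<alpha> f x / t\<bar> powr q x) \<le> ennreal E * g x"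
      proof (cases "g x = \<infinity>")
        case True
        then show ?thesis using E by (simp add: ennreal_mult_top)
      next
        case False
        then obtain B where B: "0 \<le> B" "\<bar>frac_integral N d l \<alpha> f x\<bar> \<le> m * B" "ennreal (B powr q x) \<le> g x"
          using g_max x by blast
        have "\<bar>frac_integral N d l \<alpha> f x / t\<bar> \<le> m / t * B"
          using B t by (simp add: divide_right_mono)
        then have "\<bar>frac_integral N d l \<alpha> f x / t\<bar> powr q x \<le> (m / t * B) powr q x"
          using q[OF x] by (intro powr_mono2) auto
        also have "\<dots> = (m / t) powr q x * B powr q x"
          by (rule powr_mult)
        also have "\<dots> \<le> E * B powr q x" using E(2)[OF x] by (intro mult_right_mono) auto
        finally have "ennreal (\<bar>frac_integral N d l \<alpha> f x / t\<bar> powr q x) \<le> ennreal E * ennreal (B powr q x)"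
          using E by (simp add: ennreal_mult'[symmetric] ennreal_leI)
        also have "\<dots> \<le> ennreal E * g x" by (rule mult_left_mono[OF B(3)]) simp
        finally show ?thesis .
      qed
    qed
    also have "\<dots> = ennreal E * (\<integral>\<^sup>+x. g x \<partial>N)" by (rule nn_integral_cmult) simp
    also have "\<dots> \<le> ennreal E * ennreal C" by (intro mult_left_mono g_int) simp
    also have "\<dots> = ennreal (E * C)" using E by (simp add: ennreal_mult')
    finally show ?thesis .
  qed
  have "(AE x in N. integrable N (\<lambda>y. frac_kernel d l \<alpha> x y * f y)) \<and>
        (frac_integral N d l \<alpha> f \<in> borel_measurable N \<longrightarrow> frac_integral N d l \<alpha> f \<in> var_Lebesgue N q) \<and>
        var_norm N q (frac_integral N d l \<alpha> f) \<le> ennreal (C * Lp_norm N p f)"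
    if "f \<in> Lebesgue_p N p" for f
  proof -
    have f: "f \<in> borel_measurable N" and int: "integrable N (\<lambda>y. \<bar>f y\<bar> powr p)"
      using that by (auto simp: Lebesgue_p_def)
    define L where "L = Lp_norm N p f"
    have L0: "0 \<le> L" by (simp add: L_def Lp_norm_def)
    have I: "(\<integral>\<^sup>+y. ennreal (\<bar>f y\<bar> powr p) \<partial>N) = ennreal (L powr p)"
    proof -
      have "L powr p = (\<integral>y. \<bar>f y\<bar> powr p \<partial>N)"
        using p by (simp add: L_def Lp_norm_def powr_powr)
      then show ?thesis using nn_integral_eq_integral[OF int] by simp
    qed
    have norm: "(\<integral>\<^sup>+y. ennreal (\<bar>f y\<bar> powr p) \<partial>N) \<le> ennreal ((L + e) powr p)" if "0 < e" for e
      unfolding I using L0 that p by (intro ennreal_leI powr_mono2) auto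
    have pos: "0 < L + e" if "0 < e" for e using L0 that by simp
    have "AE x in N. integrable N (\<lambda>y. frac_kernel d l \<alpha> x y * f y)"
    proof -
      obtain g where g: "g \<in> borel_measurable N" and g_int: "(\<integral>\<^sup>+x. g x \<partial>N) \<le> ennreal C"
        and g_max: "\<forall>x\<in>X. g x \<noteq> \<infinity> \<longrightarrow> integrable N (\<lambda>y. frac_kernel d l \<alpha> x y * f y) \<and>
            (\<exists>B\<ge>0. \<bar>frac_integral N d l \<alpha> f x\<bar> \<le> (L + 1) * B \<and> ennreal (B powr q x) \<le> g x)"
        using maj[OF f pos[of 1] norm[of 1]] by (auto elim!: bexE)
      have "(\<integral>\<^sup>+x. g x \<partial>N) \<noteq> \<infinity>" using g_int by (auto simp: top_unique)
      then have "AE x in N. g x \<noteq> \<infinity>" by (rule nn_integral_PInf_AE[OF g])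
      then show ?thesis
        by (rule AE_mp) (use g_max in \<open>auto simp: space_N intro!: AE_I2\<close>)
    qed
    moreover have "frac_integral N d l \<alpha> f \<in> var_Lebesgue N q"
      if "frac_integral N d l \<alpha> f \<in> borel_measurable N"
    proof -
      have "(L + 1) powr q x \<le> (L + 1) powr Q" if "x \<in> X" for x
        using L0 q[OF that] by (intro powr_mono) auto
      then have "var_modular N q (\<lambda>x. frac_integral N d l \<alpha> f x / 1) \<le> ennreal ((L + 1) powr Q * C)"
        using L0 by (intro modular[OF f pos[of 1] norm[of 1]]) auto
      then have "var_modular N q (frac_integral N d l \<alpha> f) < \<infinity>" by (simp add: le_less_trans)
      then show ?thesis using that by (simp add: var_Lebesgue_def)
    qed
    moreover have "var_norm N q (frac_integral N d l \<alpha> f) \<le> ennreal (C * L)"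
    proof (rule ennreal_le_epsilon)
      fix e :: real assume e: "0 < e"
      define m where "m = L + e / C"
      have eC: "0 < e / C" using e C by simp
      have m: "0 < m" using pos[OF eC] by (simp add: m_def)
      \<comment> \<open>dividing by \<open>C \<ge> 1\<close> gains a full factor \<open>1 / C\<close> in the modular, because \<open>q x \<ge> 1\<close>\<close>
      have "(m / (C * m)) powr q x \<le> 1 / C" if "x \<in> X" for x
      proof -
        have "(m / (C * m)) powr q x = (1 / C) powr q x" using m by simp
        also have "\<dots> \<le> (1 / C) powr 1" using C q[OF that] by (intro powr_mono') auto
        finally show ?thesis using C by simp
      qed
      then have "var_modular N q (\<lambda>x. frac_integral N d l \<alpha> f x / (C * m)) \<le> ennreal (1 / C * C)"
        using m C by (intro modular[OF f m norm[OF eC, folded m_def]]) auto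
      then have "var_norm N q (frac_integral N d l \<alpha> f) \<le> ennreal (C * m)"
        unfolding var_norm_def using m C by (intro INF_lower) auto
      also have "\<dots> = ennreal (C * L) + ennreal e"
        using C L0 e by (simp add: m_def distrib_left ennreal_plus[symmetric] del: ennreal_plus)
      finally show "var_norm N q (frac_integral N d l \<alpha> f) \<le> ennreal (C * L) + ennreal e" .
    qed
    ultimately show ?thesis by (simp add: L_def)
  qed
  then show ?thesis unfolding frac_integral_bounded_def using C by (intro exI[of _ C]) auto
qed

end

section \<open>Borel measures on a quasi-metric space\<close>

lemma space_qborel: "space (qborel X d) = X"
  by (simp add: qborel_def space_measure_of_conv)

lemma openin_sets_qborel:
  assumes "openin (qtopology X d) U"
  shows "U \<in> sets (qborel X d)"
proof -
  have "{U. openin (qtopology X d) U} \<subseteq> Pow X" by (auto simp: openin_qtopology)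
  then show ?thesis using assms by (auto simp: qborel_def sets_measure_of)
qed

theorem theorem4p1:
  fixes X :: "'a set" and d :: "'a \<Rightarrow> 'a \<Rightarrow> real" and M :: "'a measure"
    and l :: "'a \<Rightarrow> real \<Rightarrow> real" and q :: "'a \<Rightarrow> real" and \<alpha> p :: real
  assumes "quasi_metric X d"
    and "qbounded d X"
    and "geometrically_doubling X d"
    and "\<forall>x\<in>X. \<forall>r>0. openin (qtopology X d) (qball X d x r)"
    and "0 < \<alpha>"
    and "1 < p"
    and "q \<in> borel_measurable (completion M)"
    and "\<forall>x\<in>X. 1 < q x"
    and "p < (INF x\<in>X. q x)"
    and "bdd_above (q ` X)"
    and "\<forall>x\<in>X. \<forall>r>0. 0 < l x r"
    and "doubling_fun X l"
    and "\<forall>x\<in>X. mono_on {0<..} (l x)"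
    and "lower_type_greater X l \<alpha>"
    and "\<forall>x\<in>X. \<forall>r>0. r powr \<alpha> \<le> l x r powr (1 / p - 1 / q x)"
    and "sets M = sets (qborel X d)"
    and "\<forall>A\<in>sets M. qbounded d A \<longrightarrow> emeasure M A < \<infinity>"
    and "\<forall>x\<in>X. \<forall>r>0. 0 < emeasure M (qball X d x r)"
    and "\<forall>x\<in>X. emeasure M {x} = 0"
    and "upper_doubling X d M l"
  shows "frac_integral_bounded (completion M) d l \<alpha> p q"
proof -
  have space_M: "space M = X"
    using sets_eq_imp_space_eq[OF assms(16)] by (simp add: space_qborel)
  have ball_M: "qball X d x r \<in> sets M" if x: "x \<in> X" for x r
  proof (cases "0 < r")
    case True
    then have "openin (qtopology X d) (qball X d x r)" using assms(4) x by simp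
    then show ?thesis unfolding assms(16) by (rule openin_sets_qborel)
  next
    case False
    then have "qball X d x r = {}"
      using quasi_metric.nonneg[OF assms(1) _ x] by (force simp: qball_def)
    then show ?thesis by simp
  qed
  have "emeasure M X < \<infinity>"
    using assms(2,17) sets.top[of M] space_M by auto
  then have fin: "finite_measure (completion M)"
    using space_M sets.top[of M] by (intro finite_measureI) auto
  interpret quasi_metric X d by fact
  interpret finite_measure "completion M" by (rule fin)
  interpret upper_doubling_space X d "completion M" l
  proof
    show "space (completion M) = X" by (simp add: space_M)
    show "qball X d x r \<in> sets (completion M)" if "x \<in> X" for x r
      using ball_M[OF that] by (rule sets_completionI_sets)
    show "l x r \<le> l x s" if "x \<in> X" "0 < r" "r \<le> s" for x r s
      using assms(13) that by (auto simp: mono_on_def)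
    show "emeasure (completion M) (qball X d x r) \<le> ennreal (l x r)" if "x \<in> X" "0 < r" for x r
      using assms(20) ball_M[OF that(1)] that by (auto simp: upper_doubling_def)
  qed (use assms in auto)
  show ?thesis
  proof (rule frac_integral_boundedI)
    show "1 < q x \<and> q x \<le> (SUP x\<in>X. q x)" if "x \<in> X" for x
      using assms(8,10) that by (auto intro: cSUP_upper)
  qed (use assms in auto)
qed

end
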